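(* Let $0\le m\le N-1$, let $F=\{1,2,\dots,m,N\}$, and suppose $p\in s\mathcal{P}_{m,0}$ is symmetric, i.e. $\boldsymbol{T}_ip=tp$ for $1\le i<N$. Let $$z:=\big(z_1,z_2,\dots,z_m,t^{N-m-1},\dots,t^2,t,1\big).$$ Then $$p(z;\theta)=\prod_{1\le i<j\le m}(z_i-tz_j)\prod_{k=1}^m\big(z_k-t^{N-m}\big)\,p_0(z_1,\dots,z_m)\,\tau_F(\theta),$$ where $p_0$ is a polynomial in $z_1,\dots,z_m$ that is $\mathcal{S}_m$-symmetric (invariant under permutations of $z_1,\dots,z_m$).
   Context: $N\ge2$; $K$ is an extension field of $\mathbb{Q}(q,t)$ with $q,t$ algebraically independent (generic parameters). $\theta_1,\dots,\theta_N$ anti-commute ($\theta_i^2=0$, $\theta_i\theta_j=-\theta_j\theta_i$). For $E=\{i_1<\dots<i_k\}\subset\{1,\dots,N\}$ put $\phi_E=\theta_{i_1}\cdots\theta_{i_k}$, $E^C=\{1,\dots,N\}\setminus E$, $\operatorname{inv}(E)=\#\{(i,j)\in E\times E^C: i<j\}$. $\mathcal{P}_m=\operatorname{span}_K\{\phi_E:\#E=m\}$. For $1\le i<N$ the linear operator $T_i$ is: $T_i\phi_E=-\phi_E$ if $i,i+1\in E$; $t\phi_E$ if $i,i+1\notin E$; $\phi_{s_iE}$ if $i\in E,i+1\notin E$; $(t-1)\phi_E+t\phi_{s_iE}$ if $i\notin E,i+1\in E$, where $s_i$ is the transposition $(i,i+1)$. $\omega_N=1$, $\omega_i=t^{-1}T_i\omega_{i+1}T_i$.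 $D=\sum_{i=1}^N t^{i-1}\partial_i$ with $\partial_i\phi_E=(-1)^{\#\{j\in E:j<i\}}\phi_{E\setminus\{i\}}$ if $i\in E$, and $0$ otherwise. $\psi_E=D\phi_E$, $\mathcal{P}_{m,0}=\mathcal{P}_m\cap\ker D$. $\mathcal{Y}_0=\{E:\#E=m+1,\ N\in E\}$. For $E\in\mathcal{Y}_0$ with $E=\{i_1<\dots<i_{m+1}=N\}$, $E^C=\{j_1<\dots<j_{N-m-1}\}$, $Y_E$ is the hook tableau of shape $(N-m,1^m)$ with $Y_E[k,1]=i_{m+2-k}$ ($1\le k\le m+1$), $Y_E[1,k]=j_{N-m+1-k}$ ($2\le k\le N-m$); $c(i,E)=b-a$ if $Y_E[a,b]=i$. $\tau_E$ is the unique element of $\mathcal{P}_{m,0}$ with $\omega_i\tau_E=t^{c(i,E)}\tau_E$ for all $i$ and $\tau_E-t^{\operatorname{inv}(E)}\psi_E\in\operatorname{span}\{\psi_{G}:G\in\mathcal{Y}_0,\operatorname{inv}(G)<\operatorname{inv}(E)\}$. $x_1,\dots,x_N$ are commuting variables (commuting with the $\theta_i$); $s\mathcal{P}_{m,0}=K[x]\otimes\mathcal{P}_{m,0}$. For $1\le i<N$, $\boldsymbol{T}_ip(x;\theta)=(1-t)x_{i+1}\frac{p(x;\theta)-p(xs_i;\theta)}{x_i-x_{i+1}}+T_ip(xs_i;\theta)$, where $xs_i$ is $x$ with $x_i,x_{i+1}$ exchanged and $T_i$ acts on the $\theta$ variables. $p(z;\theta)$ denotes $p$ evaluated at $x=z$.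 *)

theory Defs
  imports
    "HOL-Library.Poly_Mapping"
    "HOL-Library.Function_Algebras"
    "HOL-Computational_Algebra.Polynomial"
    "HOL-Combinatorics.Permutations"
begin

text \<open>A field extension of \<open>\<rat>(q,t)\<close> is a field of characteristic 0 together with two elements
  \<open>q\<close>, \<open>t\<close> that are algebraically independent over \<open>\<rat>\<close>.\<close>

definition alg_indep2 :: "'k::field_char_0 \<Rightarrow> 'k \<Rightarrow> bool" where
  "alg_indep2 q t \<longleftrightarrow>
     (\<forall>P :: rat poly poly. poly (map_poly (\<lambda>f. poly (map_poly of_rat f) q) P) t = 0 \<longrightarrow> P = 0)"

text \<open>A linear combination \<open>\<Sum>\<^sub>E f\<^sub>E \<phi>\<^sub>E\<close>, with \<open>E\<close> ranging over the subsets of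
  \<open>{1..N}\<close>, is represented by its coefficient function \<open>f\<close>. The ring of coefficients is
  arbitrary, so that the same operators act over \<open>K\<close> and, by extension of scalars, over \<open>K[x]\<close>.\<close>

type_synonym 'r ferm = "nat set \<Rightarrow> 'r"

definition fscale :: "'r::comm_ring_1 \<Rightarrow> 'r ferm \<Rightarrow> 'r ferm" where
  "fscale c f = (\<lambda>E. c * f E)"

lemma module_fscale: "module (fscale :: 'r::comm_ring_1 \<Rightarrow> 'r ferm \<Rightarrow> 'r ferm)"
  by standard (auto simp: fscale_def fun_eq_iff algebra_simps)

lemma vector_space_fscale: "vector_space (fscale :: 'k::field \<Rightarrow> 'k ferm \<Rightarrow> 'k ferm)"
  by standard (auto simp: fscale_def fun_eq_iff algebra_simps)

definition phi :: "nat set \<Rightarrow> 'r::comm_ring_1 ferm" where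
  "phi E = (\<lambda>G. if G = E then 1 else 0)"

definition lin_ext :: "nat \<Rightarrow> (nat set \<Rightarrow> 'r::comm_ring_1 ferm) \<Rightarrow> 'r ferm \<Rightarrow> 'r ferm" where
  "lin_ext N g f = (\<Sum>E\<in>Pow {1..N}. fscale (f E) (g E))"

definition T_basis :: "'r::comm_ring_1 \<Rightarrow> nat \<Rightarrow> nat set \<Rightarrow> 'r ferm" where
  "T_basis t i E =
     (let sE = transpose i (Suc i) ` E in
      if i \<in> E \<and> Suc i \<in> E then - phi E
      else if i \<notin> E \<and> Suc i \<notin> E then fscale t (phi E)
      else if i \<in> E then phi sE
      else fscale (t - 1) (phi E) + fscale t (phi sE))"

definition T_op :: "nat \<Rightarrow> 'r::comm_ring_1 \<Rightarrow> nat \<Rightarrow> 'r ferm \<Rightarrow> 'r ferm" where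
  "T_op N t i = lin_ext N (T_basis t i)"

function omega :: "nat \<Rightarrow> 'k::field \<Rightarrow> nat \<Rightarrow> 'k ferm \<Rightarrow> 'k ferm" where
  "omega N t i f =
     (if i < N then fscale (inverse t) (T_op N t i (omega N t (Suc i) (T_op N t i f))) else f)"
  by pat_completeness auto
termination
  by (relation "measure (\<lambda>(N, t, i, f). N - i)") auto

declare omega.simps [simp del]

definition partial_basis :: "nat \<Rightarrow> nat set \<Rightarrow> 'r::comm_ring_1 ferm" where
  "partial_basis i E =
     (if i \<in> E then fscale ((- 1) ^ card {j \<in> E. j < i}) (phi (E - {i})) else 0)"

definition partial_op :: "nat \<Rightarrow> nat \<Rightarrow> 'r::comm_ring_1 ferm \<Rightarrow> 'r ferm" where
  "partial_op N i = lin_ext N (partial_basis i)"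

definition D_op :: "nat \<Rightarrow> 'r::comm_ring_1 \<Rightarrow> 'r ferm \<Rightarrow> 'r ferm" where
  "D_op N t f = (\<Sum>i=1..N. fscale (t ^ (i - 1)) (partial_op N i f))"

definition psi :: "nat \<Rightarrow> 'r::comm_ring_1 \<Rightarrow> nat set \<Rightarrow> 'r ferm" where
  "psi N t E = D_op N t (phi E)"

definition Pm :: "nat \<Rightarrow> nat \<Rightarrow> 'k::field ferm set" where
  "Pm N m = module.span fscale {phi E | E. E \<subseteq> {1..N} \<and> card E = m}"

definition Pm0 :: "nat \<Rightarrow> 'k::field \<Rightarrow> nat \<Rightarrow> 'k ferm set" where
  "Pm0 N t m = Pm N m \<inter> {f. D_op N t f = 0}"

definition invs :: "nat \<Rightarrow> nat set \<Rightarrow> nat" where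
  "invs N E = card {(i, j). i \<in> E \<and> j \<in> {1..N} - E \<and> i < j}"

definition Y0 :: "nat \<Rightarrow> nat \<Rightarrow> nat set set" where
  "Y0 N m = {E. E \<subseteq> {1..N} \<and> card E = m + 1 \<and> N \<in> E}"

definition nth_elem :: "nat set \<Rightarrow> nat \<Rightarrow> nat" where
  "nth_elem A k = sorted_list_of_set A ! (k - 1)"

definition hook_cells :: "nat \<Rightarrow> nat \<Rightarrow> (nat \<times> nat) set" where
  "hook_cells N m = {(k, 1) | k. 1 \<le> k \<and> k \<le> m + 1} \<union> {(1, k) | k. 2 \<le> k \<and> k \<le> N - m}"

text \<open>The entry \<open>Y\<^sub>E[a,b]\<close>, meaningful for \<open>(a,b)\<close> in \<open>hook_cells N m\<close> only.\<close>

definition hook_tab :: "nat \<Rightarrow> nat \<Rightarrow> nat set \<Rightarrow> nat \<Rightarrow> nat \<Rightarrow> nat" where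
  "hook_tab N m E a b =
     (if b = 1 then nth_elem E (m + 2 - a) else nth_elem ({1..N} - E) (N - m + 1 - b))"

definition content :: "nat \<Rightarrow> nat \<Rightarrow> nat set \<Rightarrow> nat \<Rightarrow> int" where
  "content N m E i =
     (THE c. \<exists>(a, b) \<in> hook_cells N m. hook_tab N m E a b = i \<and> c = int b - int a)"

definition tau :: "nat \<Rightarrow> 'k::field \<Rightarrow> nat \<Rightarrow> nat set \<Rightarrow> 'k ferm" where
  "tau N t m E =
     (THE f. f \<in> Pm0 N t m \<and>
        (\<forall>i\<in>{1..N}. omega N t i f = fscale (t powi content N m E i) f) \<and>
        f - fscale (t ^ invs N E) (psi N t E)
          \<in> module.span fscale {psi N t G | G. G \<in> Y0 N m \<and> invs N G < invs N E})"

text \<open>Polynomials in variables \<open>x\<^sub>i\<close> indexed by natural numbers; a monomial is its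
  finitely supported exponent function. Rings in finitely many variables are cut out by \<open>vars\<close>.\<close>

type_synonym 'k mpoly = "(nat \<Rightarrow>\<^sub>0 nat) \<Rightarrow>\<^sub>0 'k"

definition Const :: "'k::comm_ring_1 \<Rightarrow> 'k mpoly" where
  "Const c = Poly_Mapping.single 0 c"

definition Var :: "nat \<Rightarrow> 'k::comm_ring_1 mpoly" where
  "Var i = Poly_Mapping.single (Poly_Mapping.single i 1) 1"

definition vars :: "'k::comm_ring_1 mpoly \<Rightarrow> nat set" where
  "vars p = (\<Union>\<alpha>\<in>Poly_Mapping.keys p. Poly_Mapping.keys \<alpha>)"

definition subst :: "(nat \<Rightarrow> 'k::comm_ring_1 mpoly) \<Rightarrow> 'k mpoly \<Rightarrow> 'k mpoly" where
  "subst z p = (\<Sum>\<alpha>\<in>Poly_Mapping.keys p. Const (Poly_Mapping.lookup p \<alpha>) *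
                  (\<Prod>i\<in>Poly_Mapping.keys \<alpha>. z i ^ Poly_Mapping.lookup \<alpha> i))"

definition swap_vars :: "nat \<Rightarrow> 'k::comm_ring_1 mpoly \<Rightarrow> 'k mpoly" where
  "swap_vars i = subst (\<lambda>j. Var (transpose i (Suc i) j))"

text \<open>The exact quotient \<open>(p(x) - p(xs\<^sub>i)) / (x\<^sub>i - x\<^sub>i\<^sub>+\<^sub>1)\<close>; it is unique over a
  field, since polynomials then form an integral domain.\<close>

definition div_diff :: "nat \<Rightarrow> 'k::comm_ring_1 mpoly \<Rightarrow> 'k mpoly" where
  "div_diff i p = (THE r. r * (Var i - Var (Suc i)) = p - swap_vars i p)"

text \<open>\<open>K[x] \<otimes> P\<^sub>m\<^sub>,\<^sub>0\<close> is the direct sum of the spaces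
  \<open>x\<^sup>\<alpha> \<otimes> P\<^sub>m\<^sub>,\<^sub>0\<close>: an element is a \<open>K[x]\<close>-combination of the
  \<open>\<phi>\<^sub>E\<close> whose coefficient at each monomial \<open>x\<^sup>\<alpha>\<close> lies in \<open>P\<^sub>m\<^sub>,\<^sub>0\<close>.\<close>

definition sPm0 :: "nat \<Rightarrow> 'k::field \<Rightarrow> nat \<Rightarrow> 'k mpoly ferm set" where
  "sPm0 N t m = {p. (\<forall>E. vars (p E) \<subseteq> {1..N}) \<and>
                    (\<forall>\<alpha>. (\<lambda>E. Poly_Mapping.lookup (p E) \<alpha>) \<in> Pm0 N t m)}"

definition bT :: "nat \<Rightarrow> 'k::field \<Rightarrow> nat \<Rightarrow> 'k mpoly ferm \<Rightarrow> 'k mpoly ferm" where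
  "bT N t i p =
     (\<lambda>E. Const (1 - t) * Var (Suc i) * div_diff i (p E))
     + T_op N (Const t) i (\<lambda>E. swap_vars i (p E))"

definition symmetric_super :: "nat \<Rightarrow> 'k::field \<Rightarrow> 'k mpoly ferm \<Rightarrow> bool" where
  "symmetric_super N t p \<longleftrightarrow> (\<forall>i. 1 \<le> i \<and> i < N \<longrightarrow> bT N t i p = fscale (Const t) p)"

definition eval_super :: "(nat \<Rightarrow> 'k::comm_ring_1 mpoly) \<Rightarrow> 'k mpoly ferm \<Rightarrow> 'k mpoly ferm" where
  "eval_super z p = (\<lambda>E. subst z (p E))"

definition sym_poly :: "nat \<Rightarrow> 'k::comm_ring_1 mpoly \<Rightarrow> bool" where
  "sym_poly m p \<longleftrightarrow> vars p \<subseteq> {1..m} \<and>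
     (\<forall>\<sigma>. \<sigma> permutes {1..m} \<longrightarrow> subst (\<lambda>i. Var (\<sigma> i)) p = p)"

text \<open>The point \<open>(z\<^sub>1, \<dots>, z\<^sub>m, t\<^sup>N\<^sup>-\<^sup>m\<^sup>-\<^sup>1, \<dots>, t, 1)\<close>, where
  \<open>z\<^sub>1, \<dots>, z\<^sub>m\<close> are kept as indeterminates.\<close>

definition z_point :: "nat \<Rightarrow> 'k::comm_ring_1 \<Rightarrow> nat \<Rightarrow> nat \<Rightarrow> 'k mpoly" where
  "z_point N t m i = (if i \<le> m then Var i else Const (t ^ (N - i)))"

end

theory Submission
  imports Defs
begin

text \<open>
  At a point \<open>z\<close> with \<open>z\<^sub>j = t z\<^sub>j\<^sub>+\<^sub>1\<close>, the equation
  \<open>T\<^sub>j p = t p\<close> of the operator on superpolynomials loses its term in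
  \<open>p(z s\<^sub>j)\<close> and says that the fermionic vector \<open>p(z)\<close> is itself an eigenvector
  of the Hecke operator \<open>T\<^sub>j\<close> for the eigenvalue \<open>t\<close>. At the point of the theorem
  this happens for all \<open>m < j < N\<close>. In representation theoretic terms \<open>p(z)\<close> is then an
  invariant of the Hecke algebra of the last \<open>N - m\<close> letters in the module of hook shape
  \<open>(N - m, 1\<^sup>m)\<close>, and by the Pieri rule such invariants form a line. Here this is a short
  computation: invariance forces the coefficient of \<open>\<phi>\<^sub>E\<close> to vanish when \<open>E\<close>
  has two elements above \<open>m\<close> and to depend on \<open>E \<inter> {1..m}\<close> alone when it has
  one, and \<open>D p(z) = 0\<close> then expresses everything through the coefficient at \<open>{1..m}\<close>
  (\<open>sym_above_D_kernel_unique\<close>). The same argument applies with coefficients in the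
  polynomial ring.

  That \<open>\<tau>\<^sub>F\<close> lies on this line needs the Jucys-Murphy elements. For a vector
  invariant under \<open>T\<^sub>j\<close>, \<open>j > i\<close>, the vector \<open>\<omega>\<^sub>i f\<close> is a
  combination of \<open>f\<close> and of the sum over the orbit \<open>f, T\<^sub>i f, T\<^sub>i\<^sub>+\<^sub>1 T\<^sub>i f, \<dots>\<close>,
  which is invariant under \<open>T\<^sub>i\<close> as well (\<open>omega_eq_chain_sum\<close>). Hence the content
  eigenvalues for \<open>i > m\<close> force invariance one letter after the other. Conversely
  \<open>D\<close> applied to \<open>\<Sum>\<^sub>k\<^sub>>\<^sub>m \<phi>\<^bsub>{1..m,k}\<^esub>\<close> is an
  eigenvector with the eigenvalues of \<open>\<tau>\<^sub>F\<close>. Finally, the triangularity condition in the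
  definition of \<open>\<tau>\<^sub>F\<close> only fixes the coefficient at \<open>{1..m}\<close>, since
  \<open>\<psi>\<^sub>F\<close> is the only \<open>\<psi>\<^sub>G\<close> with \<open>N \<in> G\<close> that involves
  \<open>\<phi>\<^bsub>{1..m}\<^esub>\<close> (\<open>triangular_iff\<close>).

  Thus \<open>p(z) = g \<tau>\<^sub>F\<close> for a polynomial \<open>g\<close>. The equations for
  \<open>i < m\<close>, read off at \<open>\<phi>\<^bsub>{1..m}\<^esub>\<close>, become
  \<open>(t z\<^sub>i\<^sub>+\<^sub>1 - z\<^sub>i) g(z s\<^sub>i) = (t z\<^sub>i - z\<^sub>i\<^sub>+\<^sub>1) g(z)\<close>.
  They show that \<open>z\<^sub>i - t z\<^sub>i\<^sub>+\<^sub>1\<close> divides \<open>g\<close>, and they carry a linear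
  divisor of \<open>g\<close> to its image under \<open>s\<^sub>i\<close>, so that all
  \<open>z\<^sub>i - t z\<^sub>j\<close> divide \<open>g\<close>. When \<open>z\<^sub>m = t\<^bsup>N-m\<^esup>\<close>, the geometric
  progression has one more term, \<open>p(z)\<close> is invariant under \<open>T\<^sub>m\<close> too, and there are no
  such vectors in the kernel of \<open>D\<close> except zero; so \<open>z\<^sub>m - t\<^bsup>N-m\<^esup>\<close>, and
  with it each \<open>z\<^sub>k - t\<^bsup>N-m\<^esup>\<close>, divides \<open>g\<close>. These linear forms are pairwise
  non-associate primes, and in the quotient the exchange equations become invariance.
\<close>

section \<open>Substitution in polynomials\<close>

lemma Const_0 [simp]: "Const 0 = 0"
  by (simp add: Const_def)

lemma Const_1 [simp]: "Const 1 = 1"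
  by (simp add: Const_def)

lemma Const_add: "Const (a + b) = Const a + Const b"
  by (simp add: Const_def single_add)

lemma Const_minus: "Const (- a) = - Const a"
  by (simp add: Const_def single_uminus)

lemma Const_diff: "Const (a - b) = Const a - Const b"
  by (simp add: Const_def single_diff)

lemma Const_mult: "Const (a * b) = Const a * Const b"
  by (simp add: Const_def mult_single)

lemma Const_power: "Const (a ^ n) = Const a ^ n"
  by (induction n) (simp_all add: Const_mult)

lemma Const_sum: "Const (sum f A) = (\<Sum>i\<in>A. Const (f i))"
  by (induction A rule: infinite_finite_induct) (simp_all add: Const_add)

lemma Const_eq_iff [simp]: "Const a = Const b \<longleftrightarrow> a = b"
  unfolding Const_def by (metis lookup_single_eq)

lemma Const_eq_0_iff [simp]: "Const a = 0 \<longleftrightarrow> a = 0"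
  using Const_eq_iff[of a 0] by simp

lemma lookup_Const_mult: "Poly_Mapping.lookup (Const c * p) \<alpha> = c * Poly_Mapping.lookup p \<alpha>"
proof -
  have "Poly_Mapping.map ((*) c) p = Const c * p"
    by (simp add: mult_map_scale_conv_mult Const_def)
  then have "Poly_Mapping.lookup (Const c * p) \<alpha> = Poly_Mapping.lookup (Poly_Mapping.map ((*) c) p) \<alpha>"
    by simp
  also have "\<dots> = c * Poly_Mapping.lookup p \<alpha>"
    by transfer (simp add: when_def)
  finally show ?thesis .
qed

text \<open>The value of a monomial, so that \<open>subst\<close> is the linear extension of a multiplicative map.\<close>

definition eval_monom :: "(nat \<Rightarrow> 'k::comm_ring_1 mpoly) \<Rightarrow> (nat \<Rightarrow>\<^sub>0 nat) \<Rightarrow> 'k mpoly" where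
  "eval_monom z \<alpha> = (\<Prod>i\<in>Poly_Mapping.keys \<alpha>. z i ^ Poly_Mapping.lookup \<alpha> i)"

lemma eval_monom_superset:
  assumes "finite A" "Poly_Mapping.keys \<alpha> \<subseteq> A"
  shows "eval_monom z \<alpha> = (\<Prod>i\<in>A. z i ^ Poly_Mapping.lookup \<alpha> i)"
  unfolding eval_monom_def using assms
  by (intro prod.mono_neutral_left) (auto simp: in_keys_iff)

lemma eval_monom_add: "eval_monom z (\<alpha> + \<beta>) = eval_monom z \<alpha> * eval_monom z \<beta>"
proof -
  let ?A = "Poly_Mapping.keys \<alpha> \<union> Poly_Mapping.keys \<beta>"
  have "eval_monom z (\<alpha> + \<beta>) = (\<Prod>i\<in>?A. z i ^ Poly_Mapping.lookup (\<alpha> + \<beta>) i)"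
    using Poly_Mapping.keys_add[of \<alpha> \<beta>] by (intro eval_monom_superset) auto
  also have "\<dots> = eval_monom z \<alpha> * eval_monom z \<beta>"
    by (simp add: eval_monom_superset[of ?A] lookup_add power_add prod.distrib)
  finally show ?thesis .
qed

text \<open>Summing over a common finite superset of the supports makes substitution additive by inspection.\<close>

lemma subst_superset:
  assumes "finite A" "Poly_Mapping.keys p \<subseteq> A"
  shows "subst z p = (\<Sum>\<alpha>\<in>A. Const (Poly_Mapping.lookup p \<alpha>) * eval_monom z \<alpha>)"
  unfolding subst_def eval_monom_def[symmetric] using assms
  by (intro sum.mono_neutral_left) (auto simp: in_keys_iff)

lemma subst_0 [simp]: "subst z 0 = 0"
  by (simp add: subst_def)

lemma subst_add: "subst z (p + q) = subst z p + subst z q"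
proof -
  let ?A = "Poly_Mapping.keys p \<union> Poly_Mapping.keys q"
  have "subst z (p + q) = (\<Sum>\<alpha>\<in>?A. Const (Poly_Mapping.lookup (p + q) \<alpha>) * eval_monom z \<alpha>)"
    using Poly_Mapping.keys_add[of p q] by (intro subst_superset) auto
  then show ?thesis
    by (simp add: subst_superset[of ?A] lookup_add Const_add algebra_simps sum.distrib)
qed

lemma subst_sum: "subst z (sum f A) = (\<Sum>i\<in>A. subst z (f i))"
  by (induction A rule: infinite_finite_induct) (simp_all add: subst_add)

lemma subst_single: "subst z (Poly_Mapping.single \<alpha> c) = Const c * eval_monom z \<alpha>"
  by (subst subst_superset[of "{\<alpha>}"]) auto

lemma mpoly_eq_sum_single:
  "p = (\<Sum>\<alpha>\<in>Poly_Mapping.keys p. Poly_Mapping.single \<alpha> (Poly_Mapping.lookup p \<alpha>))"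
  by (rule poly_mapping_eqI)
     (simp add: lookup_sum lookup_single when_def in_keys_iff)

lemma subst_mult: "subst z (p * q) = subst z p * subst z q"
proof -
  have "p * q = (\<Sum>\<alpha>\<in>Poly_Mapping.keys p. \<Sum>\<beta>\<in>Poly_Mapping.keys q.
      Poly_Mapping.single (\<alpha> + \<beta>) (Poly_Mapping.lookup p \<alpha> * Poly_Mapping.lookup q \<beta>))"
    by (subst (1) mpoly_eq_sum_single[of p], subst (1) mpoly_eq_sum_single[of q])
       (simp add: sum_product mult_single)
  then have "subst z (p * q) = (\<Sum>\<alpha>\<in>Poly_Mapping.keys p. \<Sum>\<beta>\<in>Poly_Mapping.keys q.
      Const (Poly_Mapping.lookup p \<alpha>) * eval_monom z \<alpha> * (Const (Poly_Mapping.lookup q \<beta>) * eval_monom z \<beta>))"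
    by (simp add: subst_sum subst_single eval_monom_add Const_mult mult_ac)
  also have "\<dots> = subst z p * subst z q"
    by (simp add: subst_superset[OF finite_keys order_refl] sum_product)
  finally show ?thesis .
qed

lemma subst_Const [simp]: "subst z (Const c) = Const c"
  unfolding Const_def subst_single by (simp add: eval_monom_def Const_def)

lemma subst_1 [simp]: "subst z 1 = 1"
  using subst_Const[of z 1] by simp

lemma subst_Var [simp]: "subst z (Var i) = z i"
  unfolding Var_def subst_single by (simp add: eval_monom_def)

lemma subst_minus: "subst z (- p) = - subst z p"
  using subst_add[of z p "- p"] by (simp add: eq_neg_iff_add_eq_0 add.commute)

lemma subst_diff: "subst z (p - q) = subst z p - subst z q"
  using subst_add[of z p "- q"] by (simp add: subst_minus)

lemma subst_power: "subst z (p ^ n) = subst z p ^ n"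
  by (induction n) (simp_all add: subst_mult)

lemma subst_prod: "subst z (prod f A) = (\<Prod>i\<in>A. subst z (f i))"
  by (induction A rule: infinite_finite_induct) (simp_all add: subst_mult)

lemmas subst_hom = subst_add subst_diff subst_minus subst_mult subst_power subst_sum subst_prod

lemma subst_subst: "subst y (subst z p) = subst (\<lambda>i. subst y (z i)) p"
  by (simp add: subst_def[of z] subst_def[of "\<lambda>i. subst y (z i)"] subst_hom)

lemma eval_monom_Var: "eval_monom Var \<alpha> = Poly_Mapping.single \<alpha> 1"
proof -
  have pow: "Var i ^ n = (Poly_Mapping.single (Poly_Mapping.single i n) 1 :: 'a mpoly)" for i n
    by (induction n) (simp_all add: Var_def mult_single flip: single_add)
  have "(\<Prod>i\<in>A. Poly_Mapping.single (f i) 1) = (Poly_Mapping.single (sum f A) 1 :: 'a mpoly)"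
    if "finite A" for A :: "nat set" and f :: "nat \<Rightarrow> nat \<Rightarrow>\<^sub>0 nat"
    using that by (induction A) (simp_all add: mult_single)
  moreover have "(\<Sum>i\<in>Poly_Mapping.keys \<alpha>. Poly_Mapping.single i (Poly_Mapping.lookup \<alpha> i)) = \<alpha>"
    by (rule poly_mapping_eqI) (simp add: lookup_sum lookup_single when_def in_keys_iff)
  ultimately show ?thesis
    by (simp add: eval_monom_def pow)
qed

lemma subst_Var_id [simp]: "subst Var p = p"
proof -
  have "subst Var p = (\<Sum>\<alpha>\<in>Poly_Mapping.keys p. Poly_Mapping.single \<alpha> (Poly_Mapping.lookup p \<alpha>))"
    by (simp add: subst_superset[OF finite_keys order_refl] eval_monom_Var Const_def mult_single)
  then show ?thesis
    using mpoly_eq_sum_single[of p] by simp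
qed

lemma subst_cong_vars:
  assumes "\<And>i. i \<in> vars p \<Longrightarrow> y i = z i"
  shows "subst y p = subst z p"
proof -
  have "y i = z i" if "\<alpha> \<in> Poly_Mapping.keys p" "i \<in> Poly_Mapping.keys \<alpha>" for \<alpha> i
    using that by (intro assms) (auto simp: vars_def)
  then show ?thesis
    by (simp add: subst_def)
qed

text \<open>Substitution is compatible with congruences modulo \<open>d\<close>. With one of the two substitutions the identity this yields exact divisibility by \<open>Var i - c\<close>, and also by the denominator of a divided difference.\<close>

lemma subst_dvd_diff:
  assumes "\<And>i. d dvd y i - z i"
  shows "d dvd subst y p - subst z p"
proof -
  have pow: "d dvd a ^ n - b ^ n" if "d dvd a - b" for a b :: "'a mpoly" and n
    using that by (simp add: power_diff_sumr2)
  have mult: "d dvd a * a' - b * b'" if "d dvd a - b" "d dvd a' - b'" for a b a' b' :: "'a mpoly"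
  proof -
    have "a * a' - b * b' = (a - b) * a' + b * (a' - b')"
      by (simp add: algebra_simps)
    then show ?thesis
      using that by (simp add: dvd_add)
  qed
  have "d dvd (\<Prod>i\<in>A. y i ^ n i) - (\<Prod>i\<in>A. z i ^ n i)" for A and n :: "nat \<Rightarrow> nat"
    by (induction A rule: infinite_finite_induct) (auto intro!: mult pow assms)
  then have "d dvd eval_monom y \<alpha> - eval_monom z \<alpha>" for \<alpha>
    by (simp add: eval_monom_def)
  then show ?thesis
    unfolding subst_superset[OF finite_keys order_refl] sum_subtractf[symmetric]
      right_diff_distrib[symmetric]
    by (intro dvd_sum dvd_mult)
qed

lemma vars_add: "vars (p + q) \<subseteq> vars p \<union> vars q"
  using Poly_Mapping.keys_add[of p q] by (auto simp: vars_def)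

lemma vars_mult: "vars (p * q) \<subseteq> vars p \<union> vars q"
proof
  fix i assume "i \<in> vars (p * q)"
  then obtain \<gamma> where "\<gamma> \<in> Poly_Mapping.keys (p * q)" "i \<in> Poly_Mapping.keys \<gamma>"
    by (auto simp: vars_def)
  moreover from this(1) obtain \<alpha> \<beta> where "\<gamma> = \<alpha> + \<beta>" "\<alpha> \<in> Poly_Mapping.keys p" "\<beta> \<in> Poly_Mapping.keys q"
    using Poly_Mapping.keys_mult[of p q] by blast
  ultimately show "i \<in> vars p \<union> vars q"
    using Poly_Mapping.keys_add[of \<alpha> \<beta>] by (auto simp: vars_def)
qed

lemma vars_Const [simp]: "vars (Const c) = {}"
  by (simp add: vars_def Const_def)

lemma vars_Var [simp]: "vars (Var i :: 'k::comm_ring_1 mpoly) = {i}"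
  by (simp add: vars_def Var_def)

lemma vars_0 [simp]: "vars 0 = {}" and vars_1 [simp]: "vars 1 = {}"
  by (simp_all add: vars_def)

lemma vars_sum_subset: "(\<And>i. i \<in> A \<Longrightarrow> vars (f i) \<subseteq> V) \<Longrightarrow> vars (sum f A) \<subseteq> V"
  by (induction A rule: infinite_finite_induct) (auto dest!: subsetD[OF vars_add])

lemma vars_prod_subset: "(\<And>i. i \<in> A \<Longrightarrow> vars (f i) \<subseteq> V) \<Longrightarrow> vars (prod f A) \<subseteq> V"
  by (induction A rule: infinite_finite_induct) (auto dest!: subsetD[OF vars_mult])

lemma vars_power_subset: "vars (p ^ n) \<subseteq> vars p"
  by (induction n) (auto dest!: subsetD[OF vars_mult])

lemma vars_subst_subset:
  assumes "\<And>i. i \<in> vars p \<Longrightarrow> vars (z i) \<subseteq> V"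
  shows "vars (subst z p) \<subseteq> V"
  unfolding subst_def
proof (rule vars_sum_subset)
  fix \<alpha> assume \<alpha>: "\<alpha> \<in> Poly_Mapping.keys p"
  have "vars (\<Prod>i\<in>Poly_Mapping.keys \<alpha>. z i ^ Poly_Mapping.lookup \<alpha> i) \<subseteq> V"
    using assms \<alpha> vars_power_subset
    by (intro vars_prod_subset) (force simp: vars_def[of p] dest: subsetD[OF vars_power_subset])
  then show "vars (Const (Poly_Mapping.lookup p \<alpha>) *
      (\<Prod>i\<in>Poly_Mapping.keys \<alpha>. z i ^ Poly_Mapping.lookup \<alpha> i)) \<subseteq> V"
    by (auto dest!: subsetD[OF vars_mult])
qed

section \<open>Linear factors\<close>

text \<open>The factor theorem for a monic linear polynomial in one of the variables; it turns divisibility into a zero of a substitution, and so makes primality obvious.\<close>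

lemma linear_dvd_iff:
  assumes "i \<notin> vars c"
  shows "Var i - c dvd p \<longleftrightarrow> subst (Var(i := c)) p = 0"
proof
  have c: "subst (Var(i := c)) c = c"
    using subst_cong_vars[of c "Var(i := c)" Var] assms by (metis fun_upd_other subst_Var_id)
  {
    assume "Var i - c dvd p"
    then obtain r where "p = (Var i - c) * r" by (elim dvdE)
    then show "subst (Var(i := c)) p = 0"
      by (simp add: subst_hom c)
  }
  {
    assume "subst (Var(i := c)) p = 0"
    moreover have "Var i - c dvd subst Var p - subst (Var(i := c)) p"
      by (rule subst_dvd_diff) simp
    ultimately show "Var i - c dvd p" by simp
  }
qed

lemma prime_elem_linear:
  fixes c :: "'k::idom mpoly"
  assumes "i \<notin> vars c"
  shows "prime_elem (Var i - c)"
proof (rule prime_elemI)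
  show "Var i - c \<noteq> 0"
    using assms by auto
  show "\<not> Var i - c dvd 1"
    by (simp add: linear_dvd_iff[OF assms])
qed (use assms in \<open>auto simp: linear_dvd_iff subst_mult\<close>)

text \<open>The primes are split off one at a time: the next one cannot divide the product of those already split off, so it divides the cofactor.\<close>

lemma prod_prime_elems_dvd:
  assumes "finite A"
    and "\<And>a. a \<in> A \<Longrightarrow> prime_elem (L a)"
    and "\<And>a. a \<in> A \<Longrightarrow> L a dvd g"
    and "\<And>a b. a \<in> A \<Longrightarrow> b \<in> A \<Longrightarrow> a \<noteq> b \<Longrightarrow> \<not> L a dvd L b"
  shows "prod L A dvd (g :: 'a :: idom)"
  using assms
proof (induction A)
  case (insert a A)
  then obtain h where h: "g = prod L A * h"
    by (auto elim!: dvdE)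
  have prime: "prime_elem (L a)"
    using insert.prems(1) by simp
  have not_dvd: "\<not> L a dvd L b" if "b \<in> A" for b
    using insert.prems(3)[of a b] insert.hyps that by auto
  have "\<not> L a dvd prod L B" if "B \<subseteq> A" for B
    using finite_subset[OF that insert.hyps(1)] that
  proof (induction B)
    case empty
    then show ?case using prime by (auto simp: prime_elem_def)
  next
    case (insert b B)
    then show ?case
      using prime_elem_dvd_mult_iff[OF prime] not_dvd[of b]
      by auto
  qed
  moreover have "L a dvd prod L A * h"
    using insert.prems(2) h by simp
  ultimately have "L a dvd h"
    using prime_elem_dvd_mult_iff[OF prime] by blast
  then show ?case
    using insert.hyps h by (auto simp: mult.commute intro: mult_dvd_mono)
qed simp

section \<open>Polynomials with the exchange property\<close>

lemma swap_vars_hom: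
  "swap_vars i (p + q) = swap_vars i p + swap_vars i q"
  "swap_vars i (p - q) = swap_vars i p - swap_vars i q"
  "swap_vars i (- p) = - swap_vars i p"
  "swap_vars i (p * q) = swap_vars i p * swap_vars i q"
  "swap_vars i (prod f A) = (\<Prod>a\<in>A. swap_vars i (f a))"
  "swap_vars i (Const c) = Const c"
  "swap_vars i (Var j) = Var (transpose i (Suc i) j)"
  by (simp_all add: swap_vars_def subst_hom)

lemma swap_vars_dvd: "p dvd q \<Longrightarrow> swap_vars i p dvd swap_vars i q"
  by (auto simp: swap_vars_hom elim!: dvdE)

text \<open>A zero of \<open>p\<close> that is not a zero of \<open>q\<close>; all the linear forms below are told apart in this way.\<close>

lemma not_dvd_by_point:
  assumes "subst (\<lambda>i. Const (h i)) p = 0" "subst (\<lambda>i. Const (h i)) q \<noteq> 0"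
  shows "\<not> p dvd q"
  using assms by (auto simp: subst_hom elim!: dvdE)

text \<open>The transposition \<open>(a, c + 1)\<close> is the conjugate of \<open>(a, c)\<close> by an adjacent transposition.\<close>

lemma transpose_invariant_from_adjacent:
  assumes adj: "\<And>i. 1 \<le> i \<Longrightarrow> i < m \<Longrightarrow> swap_vars i p = p"
    and "1 \<le> a" "a < b" "b \<le> m"
  shows "subst (\<lambda>i. Var (transpose a b i)) p = p"
  using assms(3,4)
proof (induction b rule: less_induct)
  case (less b)
  show ?case
  proof (cases "b = Suc a")
    case True
    then show ?thesis using adj[of a] assms(2) less.prems by (simp add: swap_vars_def)
  next
    case False
    then obtain c where b: "b = Suc c" "a < c" using less.prems by (cases b) auto
    have IH: "subst (\<lambda>i. Var (transpose a c i)) p = p"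
      using less b by auto
    have sw: "subst (\<lambda>i. Var (transpose c b i)) p = p"
      using adj[of c] assms(2) b less.prems by (simp add: swap_vars_def)
    have "transpose a b i = transpose c b (transpose a c (transpose c b i))" for i
      using b by (auto simp: transpose_def)
    then have "subst (\<lambda>i. Var (transpose a b i)) p =
        subst (\<lambda>i. Var (transpose c b i)) (subst (\<lambda>i. Var (transpose a c i)) (subst (\<lambda>i. Var (transpose c b i)) p))"
      by (simp add: subst_subst)
    then show ?thesis by (simp add: IH sw)
  qed
qed

lemma sym_polyI:
  assumes "vars p \<subseteq> {1..m}" "\<And>i. 1 \<le> i \<Longrightarrow> i < m \<Longrightarrow> swap_vars i p = p"
  shows "sym_poly m p"
  unfolding sym_poly_def
proof (intro conjI allI impI)
  fix \<sigma> assume "\<sigma> permutes {1..m}"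
  from this finite_atLeastAtMost[of 1 m] show "subst (\<lambda>i. Var (\<sigma> i)) p = p"
  proof (induction rule: permutes_induct)
    case id
    then show ?case by simp
  next
    case (swap a b \<sigma>)
    have tr: "subst (\<lambda>i. Var (transpose a b i)) p = p"
      using transpose_invariant_from_adjacent[OF assms(2), of m a b]
        transpose_invariant_from_adjacent[OF assms(2), of m b a] swap.hyps
      by (cases a b rule: linorder_cases) (auto simp: transpose_commute)
    have "subst (\<lambda>i. Var ((transpose a b \<circ> \<sigma>) i)) p =
        subst (\<lambda>i. Var (transpose a b i)) (subst (\<lambda>i. Var (\<sigma> i)) p)"
      by (simp add: subst_subst)
    then show ?case using swap tr by simp
  qed
qed (rule assms(1))

text \<open>Setting the variables outside \<open>V\<close> to zero fixes both the product and its first factor, hence, after cancellation, the second.\<close>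

lemma vars_of_factor:
  fixes p q :: "'k::idom mpoly"
  assumes "vars (p * q) \<subseteq> V" "vars p \<subseteq> V" "p \<noteq> 0"
  shows "vars q \<subseteq> V"
proof -
  let ?\<pi> = "subst (\<lambda>i. if i \<in> V then Var i else 0)"
  have fixed: "?\<pi> r = r" if "vars r \<subseteq> V" for r :: "'k mpoly"
  proof -
    have "?\<pi> r = subst Var r"
      by (rule subst_cong_vars) (use that in auto)
    then show ?thesis by simp
  qed
  have "p * ?\<pi> q = p * q"
    using fixed[OF assms(1)] fixed[OF assms(2)] by (simp add: subst_mult)
  then have "?\<pi> q = q" using assms(3) by simp
  moreover have "vars (?\<pi> q) \<subseteq> V"
    by (rule vars_subst_subset) auto
  ultimately show ?thesis by simp
qed

abbreviation (input) increasing_pairs :: "nat \<Rightarrow> (nat \<times> nat) set" where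
  "increasing_pairs m \<equiv> {(i, j). 1 \<le> i \<and> i < j \<and> j \<le> m}"

lemma finite_increasing_pairs: "finite (increasing_pairs m)"
  by (rule finite_subset[of _ "{1..m} \<times> {1..m}"]) auto

definition pair_form :: "'k::field \<Rightarrow> nat \<times> nat \<Rightarrow> 'k mpoly" where
  "pair_form t = (\<lambda>(i, j). Var i - Const t * Var j)"

definition point_form :: "'k::field \<Rightarrow> nat \<Rightarrow> 'k mpoly" where
  "point_form c k = Var k - Const c"

text \<open>The exchange equation below is what the symmetry of a superpolynomial leaves for the scalar
  \<open>g\<close>: up to the linear factors, \<open>g\<close> is symmetric.\<close>

context
  fixes m :: nat and t c :: "'k::field" and g :: "'k mpoly"
  assumes t: "t \<noteq> 0" "t * t \<noteq> 1"
    and exchange: "\<And>i. 1 \<le> i \<Longrightarrow> i < m \<Longrightarrow>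
      (Const t * Var (Suc i) - Var i) * swap_vars i g = (Const t * Var i - Var (Suc i)) * g"
begin

lemma prime_pair_form: "i < j \<Longrightarrow> prime_elem (pair_form t (i, j))"
  unfolding pair_form_def by (auto intro!: prime_elem_linear dest!: subsetD[OF vars_mult])

lemma prime_point_form: "prime_elem (point_form c k)"
  unfolding point_form_def by (auto intro!: prime_elem_linear)

text \<open>The exchange equation transports prime divisors from \<open>g s\<^sub>i\<close> back to \<open>g\<close>, as long as they differ from the linear form that multiplies \<open>g\<close>.\<close>

lemma form_dvd_of_swap:
  assumes "prime_elem q" "q dvd swap_vars i g" "1 \<le> i" "i < m"
    and "\<not> q dvd Const t * Var i - Var (Suc i)"
  shows "q dvd g"
proof -
  have "q dvd (Const t * Var i - Var (Suc i)) * g"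
    using exchange[OF assms(3,4)] assms(2) by (metis dvd_mult)
  then show ?thesis using assms(1,5) prime_elem_dvd_mult_iff by blast
qed

text \<open>For neighbours this is the exchange equation itself; the general pair follows by moving the second index up one step at a time.\<close>

lemma pair_form_dvd:
  assumes "1 \<le> i" "i < j" "j \<le> m"
  shows "pair_form t (i, j) dvd g"
proof -
  have "Suc i \<le> j" using assms(2) by simp
  then show ?thesis using assms(3)
  proof (induction j rule: dec_induct)
    case base
    have "\<not> pair_form t (i, Suc i) dvd Const t * Var i - Var (Suc i)"
      by (rule not_dvd_by_point[where h = "(\<lambda>_. 0)(i := t, Suc i := 1)"])
         (use t in \<open>auto simp: pair_form_def subst_hom simp flip: Const_mult Const_diff Const_1\<close>)
    moreover have "pair_form t (i, Suc i) dvd (Const t * Var i - Var (Suc i)) * g"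
    proof -
      have "(Const t * Var i - Var (Suc i)) * g = pair_form t (i, Suc i) * (- swap_vars i g)"
        using exchange[of i] assms(1) base by (simp add: pair_form_def algebra_simps)
      then show ?thesis by (metis dvd_triv_left)
    qed
    ultimately show ?case
      using prime_pair_form[of i "Suc i"] prime_elem_dvd_mult_iff by blast
  next
    case (step j)
    have "swap_vars j (pair_form t (i, j)) dvd swap_vars j g"
      using step.IH step.prems by (intro swap_vars_dvd) simp
    moreover have "swap_vars j (pair_form t (i, j)) = pair_form t (i, Suc j)"
      using step.hyps by (simp add: pair_form_def swap_vars_hom)
    ultimately have swapped: "pair_form t (i, Suc j) dvd swap_vars j g"
      by simp
    have "\<not> pair_form t (i, Suc j) dvd Const t * Var j - Var (Suc j)"
      by (rule not_dvd_by_point[where h = "(\<lambda>_. 0)(j := 1)"])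
         (use t step.hyps in \<open>auto simp: pair_form_def subst_hom simp flip: Const_mult Const_diff Const_1\<close>)
    from form_dvd_of_swap[OF prime_pair_form swapped _ _ this] show ?case
      using step.hyps step.prems assms(1) by simp
  qed
qed

lemma point_form_dvd:
  assumes "point_form c m dvd g" "1 \<le> k" "k \<le> m"
  shows "point_form c k dvd g"
  using assms(3,2)
proof (induction k rule: inc_induct)
  case base
  then show ?case using assms(1) by simp
next
  case (step k)
  have "swap_vars k (point_form c (Suc k)) dvd swap_vars k g"
    using step.IH step.prems by (intro swap_vars_dvd) simp
  moreover have "swap_vars k (point_form c (Suc k)) = point_form c k"
    by (simp add: point_form_def swap_vars_hom)
  ultimately have swapped: "point_form c k dvd swap_vars k g"
    by simp
  have "\<not> point_form c k dvd Const t * Var k - Var (Suc k)"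
    by (rule not_dvd_by_point[where h = "(\<lambda>_. t * c + 1)(k := c)"])
       (auto simp: point_form_def subst_hom simp flip: Const_mult Const_diff Const_1)
  from form_dvd_of_swap[OF prime_point_form swapped _ _ this] show ?case
    using step.hyps step.prems by simp
qed

lemma pair_not_dvd_pair:
  assumes "i < j" "i' < j'" "(i, j) \<noteq> (i', j')"
  shows "\<not> pair_form t (i, j) dvd pair_form t (i', j')"
proof (cases "i' = i \<or> i' = j")
  case True
  then show ?thesis
    using assms t by (intro not_dvd_by_point[where h = "(\<lambda>_. 0)(j' := 1)"])
      (auto simp: pair_form_def subst_hom simp flip: Const_mult Const_diff Const_1)
next
  case False
  then show ?thesis
    using assms t by (intro not_dvd_by_point[where h = "(\<lambda>_. 0)(i' := 1)"])
      (auto simp: pair_form_def subst_hom simp flip: Const_mult Const_diff Const_1)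
qed

lemma pair_not_dvd_point:
  assumes "i < j"
  shows "\<not> pair_form t (i, j) dvd point_form c k"
proof (cases "k = i")
  case True
  then show ?thesis
    using assms t by (intro not_dvd_by_point[where h = "(\<lambda>_. (c + 1) / t)(i := c + 1)"])
      (auto simp: pair_form_def point_form_def subst_hom simp flip: Const_mult Const_diff Const_1)
next
  case False
  then show ?thesis
    using assms t by (intro not_dvd_by_point[where h = "(\<lambda>_. c + 1)(i := t * (c + 1))"])
      (auto simp: pair_form_def point_form_def subst_hom simp flip: Const_mult Const_diff Const_1)
qed

lemma point_not_dvd_pair:
  assumes "i < j"
  shows "\<not> point_form c k dvd pair_form t (i, j)"
proof (cases "k = i")
  case True
  then show ?thesis
    using assms t by (intro not_dvd_by_point[where h = "(\<lambda>_. (c + 1) / t)(k := c)"])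
      (auto simp: pair_form_def point_form_def subst_hom simp flip: Const_mult Const_diff Const_1)
next
  case False
  then show ?thesis
    using assms t by (intro not_dvd_by_point[where h = "(\<lambda>_. c)(i := t * c + 1)"])
      (auto simp: pair_form_def point_form_def subst_hom simp flip: Const_mult Const_diff Const_1)
qed

lemma point_not_dvd_point:
  assumes "k \<noteq> l"
  shows "\<not> point_form c k dvd point_form c l"
  using assms by (intro not_dvd_by_point[where h = "(\<lambda>_. c + 1)(k := c)"])
    (auto simp: point_form_def subst_hom simp flip: Const_mult Const_diff Const_1)

text \<open>Adjacent transpositions preserve the order of every pair other than \<open>(i, i + 1)\<close> itself.\<close>

lemma swap_vars_pair_prod:
  assumes i: "1 \<le> i" "i < m"
  shows "swap_vars i (prod (pair_form t) (increasing_pairs m - {(i, Suc i)})) =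
    prod (pair_form t) (increasing_pairs m - {(i, Suc i)})"
proof -
  let ?s = "transpose i (Suc i)" and ?S = "increasing_pairs m - {(i, Suc i)}"
  have "swap_vars i (prod (pair_form t) ?S) = (\<Prod>ab\<in>?S. pair_form t (map_prod ?s ?s ab))"
    unfolding swap_vars_hom by (intro prod.cong refl) (auto simp: pair_form_def swap_vars_hom)
  also have "bij_betw (map_prod ?s ?s) ?S ?S"
  proof (rule bij_betw_byWitness[where f' = "map_prod ?s ?s"])
    show "map_prod ?s ?s ` ?S \<subseteq> ?S" "map_prod ?s ?s ` ?S \<subseteq> ?S"
      using i by (auto simp: transpose_def split: if_splits)
  qed auto
  then have "(\<Prod>ab\<in>?S. pair_form t (map_prod ?s ?s ab)) = prod (pair_form t) ?S"
    by (rule prod.reindex_bij_betw)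
  finally show ?thesis .
qed

lemma swap_vars_point_prod:
  assumes "1 \<le> i" "i < m"
  shows "swap_vars i (prod (point_form c) {1..m}) = prod (point_form c) {1..m}"
proof -
  have "swap_vars i (prod (point_form c) {1..m}) = (\<Prod>k\<in>{1..m}. point_form c (transpose i (Suc i) k))"
    by (simp add: swap_vars_hom point_form_def)
  also have "\<dots> = prod (point_form c) {1..m}"
    using assms by (intro prod.reindex_bij_betw bij_betw_transpose_iff) auto
  finally show ?thesis .
qed

text \<open>All forms divide \<open>g\<close> jointly. An adjacent transposition changes only the factor of the pair \<open>(i, i + 1)\<close>, exactly by the ratio prescribed by the exchange equation; so nothing remains for the quotient, which is symmetric.\<close>

lemma exchange_factorization:
  assumes "vars g \<subseteq> {1..m}" "1 \<le> m \<Longrightarrow> point_form c m dvd g"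
  obtains p0 where "sym_poly m p0"
    "g = prod (pair_form t) (increasing_pairs m) * prod (point_form c) {1..m} * p0"
proof -
  let ?S = "increasing_pairs m"
  let ?L = "case_sum (pair_form t) (point_form c)"
  let ?\<Delta> = "prod (pair_form t) ?S" and ?\<Gamma> = "prod (point_form c) {1..m}"
  \<comment> \<open>The disjoint sum of the two index sets puts both kinds of forms into one family of primes.\<close>
  have "prod ?L (?S <+> {1..m}) dvd g"
  proof (rule prod_prime_elems_dvd)
    fix a assume "a \<in> ?S <+> {1..m}"
    then show "prime_elem (?L a)" "?L a dvd g"
      using prime_pair_form prime_point_form pair_form_dvd point_form_dvd assms(2) by auto
  next
    fix a b assume "a \<in> ?S <+> {1..m}" "b \<in> ?S <+> {1..m}" "a \<noteq> b"
    moreover have "i = i' \<and> j = j'" if "pair_form t (i, j) dvd pair_form t (i', j')" "i < j" "i' < j'" for i j i' j'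
      using pair_not_dvd_pair that by blast
    moreover have "k = l" if "point_form c k dvd point_form c l" for k l
      using point_not_dvd_point that by blast
    ultimately show "\<not> ?L a dvd ?L b"
      using pair_not_dvd_point point_not_dvd_pair by fastforce
  qed (intro finite_Plus finite_increasing_pairs finite_atLeastAtMost)
  moreover have "prod ?L (?S <+> {1..m}) = ?\<Delta> * ?\<Gamma>"
    by (subst prod.Plus[OF finite_increasing_pairs]) (simp_all add: comp_def)
  ultimately obtain p0 where g: "g = ?\<Delta> * ?\<Gamma> * p0"
    by (auto elim!: dvdE)
  have nz: "pair_form t ab \<noteq> 0" if "ab \<in> ?S" for ab
    using prime_pair_form that by (cases ab) (auto simp: prime_elem_def)
  then have \<Delta>: "?\<Delta> \<noteq> 0" using prod_zero_iff[OF finite_increasing_pairs[of m]] by blast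
  have "point_form c k \<noteq> 0" for k using prime_point_form[of k] by (auto simp: prime_elem_def)
  then have \<Gamma>: "?\<Gamma> \<noteq> 0" by simp
  have "swap_vars i p0 = p0" if i: "1 \<le> i" "i < m" for i
  proof -
    let ?R = "prod (pair_form t) (?S - {(i, Suc i)})"
    have \<Delta>_split: "?\<Delta> = pair_form t (i, Suc i) * ?R"
      using i by (intro prod.remove finite_increasing_pairs) auto
    have "swap_vars i ?\<Delta> = pair_form t (Suc i, i) * ?R"
      unfolding \<Delta>_split by (simp only: swap_vars_hom(4) swap_vars_pair_prod[OF i])
        (simp add: pair_form_def swap_vars_hom)
    then have swap_g: "swap_vars i g = pair_form t (Suc i, i) * ?R * ?\<Gamma> * swap_vars i p0"
      unfolding g by (simp only: swap_vars_hom(4) swap_vars_point_prod[OF i])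
    have forms: "Const t * Var (Suc i) - Var i = - pair_form t (i, Suc i)"
      "Const t * Var i - Var (Suc i) = - pair_form t (Suc i, i)"
      by (simp_all add: pair_form_def)
    have "pair_form t (i, Suc i) * swap_vars i g = pair_form t (Suc i, i) * g"
      using exchange[OF i] unfolding forms by simp
    then have "pair_form t (i, Suc i) * (pair_form t (Suc i, i) * ?R * ?\<Gamma> * swap_vars i p0) =
        pair_form t (Suc i, i) * (?\<Delta> * ?\<Gamma> * p0)"
      by (simp only: swap_g g[symmetric])
    then have eq: "(pair_form t (Suc i, i) * (?\<Delta> * ?\<Gamma>)) * swap_vars i p0 = (pair_form t (Suc i, i) * (?\<Delta> * ?\<Gamma>)) * p0"
      unfolding \<Delta>_split by (simp only: mult_ac)
    have "subst (\<lambda>j. Const (if j = Suc i then 1 else 0)) (pair_form t (Suc i, i)) \<noteq> 0"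
      by (simp add: pair_form_def subst_hom)
    then have "pair_form t (Suc i, i) \<noteq> 0" by auto
    then have "pair_form t (Suc i, i) * (?\<Delta> * ?\<Gamma>) \<noteq> 0"
      by (intro no_zero_divisors \<Delta> \<Gamma>)
    from eq show ?thesis
      by (simp only: mult_left_cancel[OF \<open>pair_form t (Suc i, i) * (?\<Delta> * ?\<Gamma>) \<noteq> 0\<close>])
  qed
  moreover have "vars p0 \<subseteq> {1..m}"
  proof (rule vars_of_factor)
    show "vars (?\<Delta> * ?\<Gamma> * p0) \<subseteq> {1..m}" using assms(1) g by simp
    have "vars (pair_form t ab) \<subseteq> {1..m}" if "ab \<in> ?S" for ab
      using that by (cases ab) (auto simp: pair_form_def diff_conv_add_uminus[of "Var _"]
          simp flip: Const_minus mult_minus_left dest!: subsetD[OF vars_add] subsetD[OF vars_mult])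
    then have "vars ?\<Delta> \<subseteq> {1..m}" by (rule vars_prod_subset)
    moreover have "vars (point_form c k) \<subseteq> {1..m}" if "k \<in> {1..m}" for k
      using that by (auto simp: point_form_def diff_conv_add_uminus[of "Var _"]
          simp flip: Const_minus dest!: subsetD[OF vars_add])
    then have "vars ?\<Gamma> \<subseteq> {1..m}" by (rule vars_prod_subset)
    ultimately show "vars (?\<Delta> * ?\<Gamma>) \<subseteq> {1..m}"
      by (auto dest!: subsetD[OF vars_mult])
  qed (use \<Delta> \<Gamma> in simp)
  ultimately have "sym_poly m p0" by (intro sym_polyI)
  then show thesis using g by (rule that)
qed

end

section \<open>The Hecke operators in coordinates\<close>

abbreviation swap_set :: "nat \<Rightarrow> nat set \<Rightarrow> nat set" where
  "swap_set i E \<equiv> transpose i (Suc i) ` E"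

lemma swap_set_subset:
  assumes "1 \<le> i" "i < N"
  shows "swap_set i E \<subseteq> {1..N} \<longleftrightarrow> E \<subseteq> {1..N}"
proof -
  have *: "swap_set i E \<subseteq> {1..N}" if "E \<subseteq> {1..N}" for E
    using that assms by (auto simp: transpose_def)
  show ?thesis
    using *[of E] *[of "swap_set i E"] by (auto simp: image_comp)
qed

lemma fun_sum_apply: "(\<Sum>i\<in>A. f i) x = (\<Sum>i\<in>A. f i x)"
  for f :: "'a \<Rightarrow> 'b \<Rightarrow> 'c::comm_monoid_add"
  by (induction A rule: infinite_finite_induct) auto

lemma lin_ext_apply: "lin_ext N g f E = (\<Sum>G\<in>Pow {1..N}. f G * g G E)"
  by (simp add: lin_ext_def fun_sum_apply fscale_def)

text \<open>The coefficients of \<open>T\<^sub>i f\<close>: the transpose of the action on the basis, which is why the factor \<open>t\<close> now appears for \<open>i \<in> E\<close>.\<close>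

lemma T_op_apply:
  fixes t :: "'r::comm_ring_1"
  assumes "1 \<le> i" "i < N"
  shows "T_op N t i f E =
    (if \<not> E \<subseteq> {1..N} then 0
     else if i \<in> E then if Suc i \<in> E then - f E else t * f (swap_set i E)
     else if Suc i \<in> E then f (swap_set i E) + (t - 1) * f E else t * f E)"
proof (cases "E \<subseteq> {1..N}")
  case True
  let ?s = "swap_set i"
  have ss: "?s (?s G) = G" for G by (simp add: image_comp)
  have mem: "i \<in> ?s G \<longleftrightarrow> Suc i \<in> G" "Suc i \<in> ?s G \<longleftrightarrow> i \<in> G" for G
    by (simp_all add: in_transpose_image_iff)
  have eq: "E = ?s G \<longleftrightarrow> G = ?s E" for G using ss by metis
  have 0: "T_basis t i G E = 0" if "G \<noteq> E" "G \<noteq> ?s E" for G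
    using that eq[of G] by (auto simp: T_basis_def Let_def phi_def fscale_def)
  have "T_op N t i f E = (\<Sum>G\<in>{E, ?s E}. f G * T_basis t i G E)"
    unfolding T_op_def lin_ext_apply
    by (rule sum.mono_neutral_right) (use True swap_set_subset[OF assms] 0 in auto)
  then show ?thesis
    using True by (cases "?s E = E")
      (auto simp: T_basis_def Let_def phi_def fscale_def mem ss algebra_simps
        dest: arg_cong[where f = "\<lambda>G. i \<in> G"] simp del: transpose_image_eq)
next
  case False
  have "T_basis t i G E = 0" if "G \<subseteq> {1..N}" for G
    using that False swap_set_subset[OF assms, of G]
    by (auto simp: T_basis_def Let_def phi_def fscale_def)
  then show ?thesis
    using False unfolding T_op_def lin_ext_apply by (auto intro!: sum.neutral)
qed

text \<open>Elements of the span \<open>P\<^sub>m\<close>, over an arbitrary ring of coefficients.\<close>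

definition supported :: "nat \<Rightarrow> nat \<Rightarrow> 'r::comm_ring_1 ferm \<Rightarrow> bool" where
  "supported N m f \<longleftrightarrow> (\<forall>E. f E \<noteq> 0 \<longrightarrow> E \<subseteq> {1..N} \<and> card E = m)"

lemma supportedD: "supported N m f \<Longrightarrow> \<not> (E \<subseteq> {1..N} \<and> card E = m) \<Longrightarrow> f E = 0"
  unfolding supported_def by blast

lemma card_swap_set [simp]: "card (swap_set i E) = card E"
  by (simp add: card_image inj_on_transpose)

lemma supported_T_op:
  assumes "1 \<le> i" "i < N" "supported N m f"
  shows "supported N m (T_op N t i f)"
  using assms(3) swap_set_subset[OF assms(1,2)]
  by (auto simp: supported_def T_op_apply[OF assms(1,2)] split: if_splits)
     (metis add.left_neutral card_swap_set mult_zero_right)+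

lemma T_op_add: "T_op N t i (f + g) = T_op N t i f + T_op N t i g"
  by (rule ext) (simp add: T_op_def lin_ext_apply algebra_simps sum.distrib)

lemma T_op_fscale: "T_op N t i (fscale c f) = fscale c (T_op N t i f)"
  by (rule ext) (simp add: T_op_def lin_ext_apply fscale_def sum_distrib_left mult_ac)

lemma T_op_0 [simp]: "T_op N t i 0 = 0"
  by (rule ext) (simp add: T_op_def lin_ext_apply)

lemma T_op_sum: "T_op N t i (\<Sum>j\<in>A. f j) = (\<Sum>j\<in>A. T_op N t i (f j))"
  by (rule ext) (simp add: T_op_def lin_ext_apply fun_sum_apply sum_distrib_right sum.swap[of _ _ A])

lemma T_op_quadratic:
  assumes "1 \<le> i" "i < N" "supported N m f"
  shows "T_op N t i (T_op N t i f) = fscale (t - 1) (T_op N t i f) + fscale t f"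
proof
  fix E
  have mem: "i \<in> swap_set i G \<longleftrightarrow> Suc i \<in> G" "Suc i \<in> swap_set i G \<longleftrightarrow> i \<in> G" for G
    by (simp_all add: in_transpose_image_iff)
  show "T_op N t i (T_op N t i f) E = (fscale (t - 1) (T_op N t i f) + fscale t f) E"
    using swap_set_subset[OF assms(1,2), of E] supportedD[OF assms(3), of E]
    by (auto simp: T_op_apply[OF assms(1,2)] fscale_def mem image_comp algebra_simps)
qed

lemma T_op_far_commute:
  assumes "1 \<le> i" "Suc i < j" "j < N"
  shows "T_op N t i (T_op N t j f) = T_op N t j (T_op N t i f)"
proof
  fix E
  have mem: "i \<in> swap_set j G \<longleftrightarrow> i \<in> G" "Suc i \<in> swap_set j G \<longleftrightarrow> Suc i \<in> G"
    "j \<in> swap_set i G \<longleftrightarrow> j \<in> G" "Suc j \<in> swap_set i G \<longleftrightarrow> Suc j \<in> G" for G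
    using assms unfolding in_transpose_image_iff by (auto simp: transpose_def)
  have comm: "swap_set i (swap_set j E) = swap_set j (swap_set i E)"
    using assms by (auto simp: set_eq_iff in_transpose_image_iff transpose_def)
  have i: "1 \<le> i" "i < N" "1 \<le> j" "j < N" using assms by auto
  note sub = swap_set_subset[OF i(1,2)] swap_set_subset[OF i(3,4)]
  show "T_op N t i (T_op N t j f) E = T_op N t j (T_op N t i f) E"
    by (cases "i \<in> E"; cases "Suc i \<in> E"; cases "j \<in> E"; cases "Suc j \<in> E")
       (simp_all add: T_op_apply[OF i(1,2)] T_op_apply[OF i(3,4)] mem comm sub algebra_simps
         del: transpose_image_eq One_nat_def)
qed

text \<open>The eight membership patterns of \<open>i, i + 1, i + 2\<close> in \<open>E\<close> are compared one by one.\<close>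

lemma T_op_braid:
  assumes "1 \<le> i" "Suc i < N"
  shows "T_op N t i (T_op N t (Suc i) (T_op N t i f)) =
    T_op N t (Suc i) (T_op N t i (T_op N t (Suc i) f))"
proof
  fix E
  let ?s = "swap_set i" and ?u = "swap_set (Suc i)"
  have mem: "i \<in> ?s G \<longleftrightarrow> Suc i \<in> G" "Suc i \<in> ?s G \<longleftrightarrow> i \<in> G" "Suc (Suc i) \<in> ?s G \<longleftrightarrow> Suc (Suc i) \<in> G"
    "i \<in> ?u G \<longleftrightarrow> i \<in> G" "Suc i \<in> ?u G \<longleftrightarrow> Suc (Suc i) \<in> G" "Suc (Suc i) \<in> ?u G \<longleftrightarrow> Suc i \<in> G" for G
    unfolding in_transpose_image_iff by (auto simp: transpose_def)
  have "transpose i (Suc i) (transpose (Suc i) (Suc (Suc i)) (transpose i (Suc i) x)) =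
      transpose (Suc i) (Suc (Suc i)) (transpose i (Suc i) (transpose (Suc i) (Suc (Suc i)) x))" for x
    by (simp add: transpose_def)
  then have braid: "?s (?u (?s E)) = ?u (?s (?u E))"
    by (simp only: set_eq_iff in_transpose_image_iff simp_thms)
  have inv: "?s (?s G) = G" "?u (?u G) = G" for G
    by (simp_all add: image_comp)
  have i: "1 \<le> i" "i < N" "1 \<le> Suc i" "Suc i < N" using assms by auto
  note sub = swap_set_subset[OF i(1,2)] swap_set_subset[OF i(3,4)]
  show "T_op N t i (T_op N t (Suc i) (T_op N t i f)) E =
      T_op N t (Suc i) (T_op N t i (T_op N t (Suc i) f)) E"
    by (cases "i \<in> E"; cases "Suc i \<in> E"; cases "Suc (Suc i) \<in> E")
       (simp_all add: T_op_apply[OF i(1,2)] T_op_apply[OF i(3,4)] mem braid inv sub algebra_simps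
         del: One_nat_def)
qed

section \<open>The operator D\<close>

text \<open>The coefficient of \<open>\<phi>\<^sub>G\<close> in \<open>D \<phi>\<^bsub>G \<union> {i}\<^esub>\<close> for \<open>i \<notin> G\<close>.\<close>

definition D_coeff :: "'r::comm_ring_1 \<Rightarrow> nat set \<Rightarrow> nat \<Rightarrow> 'r" where
  "D_coeff t G i = t ^ (i - 1) * (- 1) ^ card {j \<in> G. j < i}"

lemma partial_op_apply:
  fixes f :: "'r::comm_ring_1 ferm"
  assumes "i \<in> {1..N}"
  shows "partial_op N i f G =
    (if G \<subseteq> {1..N} \<and> i \<notin> G then (- 1) ^ card {j \<in> G. j < i} * f (insert i G) else 0)"
proof (cases "G \<subseteq> {1..N} \<and> i \<notin> G")
  case True
  have "{j \<in> insert i G. j < i} = {j \<in> G. j < i}" by auto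
  then have *: "partial_basis i (insert i G) G = (- 1 :: 'r) ^ card {j \<in> G. j < i}"
    using True by (simp add: partial_basis_def fscale_def phi_def)
  have "partial_op N i f G = (\<Sum>E\<in>{insert i G}. f E * partial_basis i E G)"
    unfolding partial_op_def lin_ext_apply using True assms
    by (intro sum.mono_neutral_right) (auto simp: partial_basis_def fscale_def phi_def)
  then show ?thesis using True * by simp
next
  case False
  then have "partial_basis i E G = (0 :: 'r)" if "E \<subseteq> {1..N}" for E
    using that by (auto simp: partial_basis_def fscale_def phi_def)
  then show ?thesis
    using False unfolding partial_op_def lin_ext_apply by (auto intro!: sum.neutral)
qed

lemma D_op_apply:
  "D_op N t f G = (if G \<subseteq> {1..N} then \<Sum>i\<in>{1..N} - G. D_coeff t G i * f (insert i G) else 0)"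
proof -
  have "D_op N t f G = (\<Sum>i=1..N. t ^ (i - 1) * partial_op N i f G)"
    by (simp add: D_op_def fun_sum_apply fscale_def)
  also have "\<dots> = (\<Sum>i=1..N. if i \<in> {1..N} - G then if G \<subseteq> {1..N} then D_coeff t G i * f (insert i G) else 0 else 0)"
    by (intro sum.cong refl) (simp add: partial_op_apply D_coeff_def mult_ac del: One_nat_def)
  also have "\<dots> = (\<Sum>i\<in>{1..N} \<inter> ({1..N} - G). if G \<subseteq> {1..N} then D_coeff t G i * f (insert i G) else 0)"
    by (subst sum.inter_restrict) auto
  also have "{1..N} \<inter> ({1..N} - G) = {1..N} - G" by auto
  finally show ?thesis by simp
qed

lemma D_op_fscale: "D_op N t (fscale c f) = fscale c (D_op N t f)"
  by (rule ext) (simp add: D_op_apply fscale_def sum_distrib_left mult_ac)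

lemma D_op_0 [simp]: "D_op N t 0 = 0"
  by (rule ext) (simp add: D_op_apply)

lemma D_op_sum: "D_op N t (\<Sum>j\<in>A. f j) = (\<Sum>j\<in>A. D_op N t (f j))"
  by (rule ext) (simp add: D_op_apply fun_sum_apply sum_distrib_left sum.swap[of _ _ A])

lemma supported_D_op:
  assumes "supported N (Suc m) f"
  shows "supported N m (D_op N t f)"
  unfolding supported_def
proof (intro allI impI)
  fix G assume nz: "D_op N t f G \<noteq> 0"
  then have G: "G \<subseteq> {1..N}" by (auto simp: D_op_apply split: if_splits)
  then have "(\<Sum>i\<in>{1..N} - G. D_coeff t G i * f (insert i G)) \<noteq> 0"
    using nz by (simp add: D_op_apply)
  then obtain i where "i \<in> {1..N} - G" "D_coeff t G i * f (insert i G) \<noteq> 0"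
    by (rule sum.not_neutral_contains_not_neutral)
  then have i: "i \<in> {1..N} - G" "f (insert i G) \<noteq> 0"
    by auto
  then have "card (insert i G) = Suc m"
    using assms by (auto simp: supported_def)
  then show "G \<subseteq> {1..N} \<and> card G = m"
    using G i finite_subset[OF G] by auto
qed

text \<open>Removing two elements in either order gives opposite signs, because the smaller one is counted only if it is still there.\<close>

lemma D_coeff_antisym:
  assumes "i \<noteq> l" "i \<notin> G" "l \<notin> G" "finite G"
  shows "D_coeff t G i * D_coeff t (insert i G) l = - (D_coeff t G l * D_coeff t (insert l G) i)"
proof -
  have *: "D_coeff t G i * D_coeff t (insert i G) l = - (D_coeff t G l * D_coeff t (insert l G) i)"
    if "i < l" "i \<notin> G" for i l
  proof -
    have "{j \<in> insert i G. j < l} = insert i {j \<in> G. j < l}" "{j \<in> insert l G. j < i} = {j \<in> G. j < i}"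
      using that by auto
    then show ?thesis
      using that assms(4) by (simp add: D_coeff_def mult_ac)
  qed
  show ?thesis
    using *[of i l] *[of l i] assms by (cases "i < l") auto
qed

lemma D_op_D_op:
  fixes t :: "'r::{idom, ring_char_0}"
  shows "D_op N t (D_op N t f) = 0"
proof
  fix G
  show "D_op N t (D_op N t f) G = 0 G"
  proof (cases "G \<subseteq> {1..N}")
    case True
    let ?I = "{1..N} - G"
    define w where "w i l = (if i = l then 0 else
      D_coeff t G i * D_coeff t (insert i G) l * f (insert l (insert i G)))" for i l
    have fin: "finite G" using True finite_subset by blast
    \<comment> \<open>The double sum over ordered pairs equals its own negative.\<close>
    have w: "w i l = - w l i" if "i \<in> ?I" "l \<in> ?I" for i l
      using D_coeff_antisym[of i l G t] that fin by (auto simp: w_def insert_commute)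
    have inner: "D_coeff t G i * D_op N t f (insert i G) = (\<Sum>l\<in>?I. w i l)" if "i \<in> ?I" for i
    proof -
      have "(\<Sum>l\<in>?I. w i l) = (\<Sum>l\<in>{1..N} - insert i G. w i l)"
        by (rule sum.mono_neutral_right) (auto simp: w_def)
      also have "\<dots> = D_coeff t G i * D_op N t f (insert i G)"
        using True that by (auto simp: D_op_apply sum_distrib_left w_def mult_ac intro!: sum.cong)
      finally show ?thesis by simp
    qed
    have "D_op N t (D_op N t f) G = (\<Sum>i\<in>?I. D_coeff t G i * D_op N t f (insert i G))"
      using True by (simp add: D_op_apply[of N t "D_op N t f"])
    also have "\<dots> = (\<Sum>i\<in>?I. \<Sum>l\<in>?I. w i l)"
      by (rule sum.cong[OF refl inner])
    finally have 1: "D_op N t (D_op N t f) G = (\<Sum>i\<in>?I. \<Sum>l\<in>?I. w i l)" .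
    also have "\<dots> = (\<Sum>i\<in>?I. \<Sum>l\<in>?I. - w l i)"
      by (intro sum.cong refl w)
    also have "\<dots> = - (\<Sum>i\<in>?I. \<Sum>l\<in>?I. w i l)"
      by (subst sum.swap) (simp add: sum_negf)
    finally show ?thesis using 1 by simp
  qed (simp add: D_op_apply)
qed

text \<open>Elements other than \<open>i, i + 1\<close> are removed with the same coefficient before and after applying \<open>s\<^sub>i\<close>. For the remaining one or two terms the weight \<open>t\<^bsup>i-1\<^esup>\<close> in \<open>D\<close> is just right: passing from \<open>i\<close> to \<open>i + 1\<close> costs a factor \<open>t\<close>, with a sign when the other element is present.\<close>

lemma D_op_T_op:
  assumes "1 \<le> i" "i < N"
  shows "D_op N t (T_op N t i f) = T_op N t i (D_op N t f)"
proof
  fix G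
  show "D_op N t (T_op N t i f) G = T_op N t i (D_op N t f) G"
  proof (cases "G \<subseteq> {1..N}")
    case False
    then show ?thesis by (simp add: D_op_apply T_op_apply[OF assms])
  next
    case True
    let ?s = "swap_set i"
    define R where "R = {1..N} - G - {i, Suc i}"
    define e where "e = D_coeff t G i"
    note T = T_op_apply[OF assms]
    have sG: "?s G \<subseteq> {1..N}" using True swap_set_subset[OF assms] by blast
    have fin: "finite G" "finite R" using True finite_subset by (auto simp: R_def)
    have mem: "i \<in> ?s H \<longleftrightarrow> Suc i \<in> H" "Suc i \<in> ?s H \<longleftrightarrow> i \<in> H" for H
      by (simp_all add: in_transpose_image_iff)
    have split: "D_op N t h H = (\<Sum>l\<in>R. D_coeff t H l * h (insert l H))
        + (if i \<in> H then 0 else D_coeff t H i * h (insert i H))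
        + (if Suc i \<in> H then 0 else D_coeff t H (Suc i) * h (insert (Suc i) H))"
      if H: "H \<subseteq> {1..N}" "{1..N} - H - {i, Suc i} = R" for h H
    proof -
      have "{1..N} - H = R \<union> ((if i \<in> H then {} else {i}) \<union> (if Suc i \<in> H then {} else {Suc i}))"
        using assms H(2) by auto
      then have "D_op N t h H = (\<Sum>l\<in>R \<union> ((if i \<in> H then {} else {i}) \<union> (if Suc i \<in> H then {} else {Suc i})).
          D_coeff t H l * h (insert l H))"
        using H(1) by (simp add: D_op_apply)
      also have "\<dots> = (\<Sum>l\<in>R. D_coeff t H l * h (insert l H))
         + (\<Sum>l\<in>(if i \<in> H then {} else {i}) \<union> (if Suc i \<in> H then {} else {Suc i}). D_coeff t H l * h (insert l H))"
        by (rule sum.union_disjoint) (auto simp: R_def)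
      finally show ?thesis by (simp add: add.assoc)
    qed
    have RsG: "{1..N} - ?s G - {i, Suc i} = R"
      by (auto simp: R_def in_transpose_image_iff transpose_def)
    have other: "D_coeff t (?s G) l = D_coeff t G l" if "l \<noteq> Suc i" for l
    proof -
      have "{j \<in> ?s G. j < l} = ?s {j \<in> G. j < l}"
        using that unfolding set_eq_iff mem_Collect_eq in_transpose_image_iff
        by (auto simp: transpose_def)
      then show ?thesis by (simp add: D_coeff_def card_swap_set)
    qed
    \<comment> \<open>\<open>e\<close> is the coefficient for removing \<open>i\<close>; the one for \<open>i + 1\<close> also counts \<open>i\<close> if it is present.\<close>
    have next_coeff: "D_coeff t G (Suc i) = (if i \<in> G then - (t * e) else t * e)"
    proof -
      have "{j \<in> G. j < Suc i} = (if i \<in> G then insert i {j \<in> G. j < i} else {j \<in> G. j < i})"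
        by (auto simp: less_Suc_eq)
      moreover have "t ^ i = t * t ^ (i - 1)" using assms by (cases i) auto
      ultimately show ?thesis
        using fin(1) by (simp add: D_coeff_def e_def mult_ac)
    qed
    have next_coeff_swap: "D_coeff t (?s G) (Suc i) = (if Suc i \<in> G then - (t * e) else t * e)"
    proof -
      have "{j \<in> ?s G. j < Suc i} = (if Suc i \<in> G then insert i {j \<in> G. j < i} else {j \<in> G. j < i})"
        unfolding set_eq_iff by (auto simp: less_Suc_eq in_transpose_image_iff transpose_def)
      moreover have "t ^ i = t * t ^ (i - 1)" using assms by (cases i) auto
      ultimately show ?thesis
        using fin(1) by (simp add: D_coeff_def e_def mult_ac)
    qed
    have ins: "insert l (?s G) = ?s (insert l G)" if "l \<in> R" for l
      using that by (auto simp: R_def transpose_def)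
    have sub: "insert l G \<subseteq> {1..N}" "i \<in> insert l G \<longleftrightarrow> i \<in> G" "Suc i \<in> insert l G \<longleftrightarrow> Suc i \<in> G"
      if "l \<in> R" for l
      using that True by (auto simp: R_def)
    have sub': "insert i G \<subseteq> {1..N}" "insert (Suc i) G \<subseteq> {1..N}"
      using True assms by auto
    have ins': "?s (insert i G) = insert (Suc i) G" if "i \<notin> G" "Suc i \<notin> G"
      using that by (simp add: image_insert)
    have ins'': "?s (insert (Suc i) G) = insert i G" if "i \<notin> G" "Suc i \<notin> G"
      using that by (simp add: image_insert)
    have swap_ins: "insert (Suc i) (?s G) = insert i G" if "i \<notin> G" "Suc i \<in> G"
      using that unfolding set_eq_iff insert_iff in_transpose_image_iff by (auto simp: transpose_def)
    have swap_ins': "insert i (?s G) = insert (Suc i) G" if "i \<in> G" "Suc i \<notin> G"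
      using that unfolding set_eq_iff insert_iff in_transpose_image_iff by (auto simp: transpose_def)
    have split_G: "D_op N t h G = (\<Sum>l\<in>R. D_coeff t G l * h (insert l G))
        + (if i \<in> G then 0 else e * h (insert i G))
        + (if Suc i \<in> G then 0 else (if i \<in> G then - (t * e) else t * e) * h (insert (Suc i) G))" for h
      using split[OF True, of h] by (simp add: R_def e_def next_coeff)
    have split_sG: "D_op N t f (?s G) = (\<Sum>l\<in>R. D_coeff t G l * f (?s (insert l G)))
        + (if Suc i \<in> G then 0 else e * f (insert i (?s G)))
        + (if i \<in> G then 0 else (if Suc i \<in> G then - (t * e) else t * e) * f (insert (Suc i) (?s G)))"
      unfolding split[OF sG RsG] mem next_coeff_swap
      using ins other[of i] by (auto simp: e_def R_def other intro!: sum.cong arg_cong2[of _ _ _ _ "(+)"])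
    have rest: "(\<Sum>l\<in>R. D_coeff t G l * T_op N t i f (insert l G)) =
      (if i \<in> G then if Suc i \<in> G then - (\<Sum>l\<in>R. D_coeff t G l * f (insert l G))
         else t * (\<Sum>l\<in>R. D_coeff t G l * f (?s (insert l G)))
       else if Suc i \<in> G then (\<Sum>l\<in>R. D_coeff t G l * f (?s (insert l G)))
           + (t - 1) * (\<Sum>l\<in>R. D_coeff t G l * f (insert l G))
         else t * (\<Sum>l\<in>R. D_coeff t G l * f (insert l G)))"
      by (simp add: T sub sum_distrib_left sum_negf sum.distrib sum_subtractf algebra_simps
          del: image_insert One_nat_def insert_iff insert_subset)
    show ?thesis
      unfolding split_G[of "T_op N t i f"] T[of _ _ G] split_sG split_G[of f] rest
      using True sub'
      by (cases "i \<in> G"; cases "Suc i \<in> G")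
        (simp_all add: T ins' ins'' swap_ins swap_ins' algebra_simps del: image_insert insert_subset One_nat_def)
  qed
qed

section \<open>Jucys-Murphy elements on partially symmetric vectors\<close>

text \<open>The vectors \<open>T\<^bsub>i+k-1\<^esub> \<dots> T\<^sub>i f\<close>. When \<open>f\<close> is invariant under the operators with larger index, they span the module induced from \<open>f\<close> to one more letter.\<close>

primrec chain :: "nat \<Rightarrow> 'r::comm_ring_1 \<Rightarrow> nat \<Rightarrow> 'r ferm \<Rightarrow> nat \<Rightarrow> 'r ferm" where
  "chain N t i f 0 = f"
| "chain N t i f (Suc k) = T_op N t (i + k) (chain N t i f k)"

context
  fixes N m i :: nat and t :: "'k::field" and f :: "'k ferm"
  assumes i: "1 \<le> i" "i \<le> N"
    and supp: "supported N m f"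
    and inv: "\<And>j. i < j \<Longrightarrow> j < N \<Longrightarrow> T_op N t j f = fscale t f"
begin

abbreviation "ch \<equiv> chain N t i f"

lemma supported_chain: "i + k \<le> N \<Longrightarrow> supported N m (ch k)"
  using i by (induction k) (auto intro!: supported_T_op supp)

text \<open>\<open>T\<^sub>j\<close> commutes with every operator applied so far.\<close>

lemma chain_far: "i + k < j \<Longrightarrow> j < N \<Longrightarrow> T_op N t j (ch k) = fscale t (ch k)"
proof (induction k)
  case (Suc k)
  have "T_op N t j (ch (Suc k)) = T_op N t (i + k) (T_op N t j (ch k))"
    using Suc.prems i by (simp add: T_op_far_commute)
  then show ?case using Suc by (simp add: T_op_fscale)
qed (simp add: inv)

text \<open>\<open>T\<^sub>j\<close> passes to the factors \<open>T\<^sub>j\<^sub>+\<^sub>1 T\<^sub>j\<close> in the middle of the chain, where the braid relation turns it into \<open>T\<^sub>j\<^sub>+\<^sub>1\<close> acting on an earlier, still invariant vector.\<close>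

lemma chain_near: "i \<le> j \<Longrightarrow> j + 2 \<le> i + k \<Longrightarrow> i + k \<le> N \<Longrightarrow> T_op N t j (ch k) = fscale t (ch k)"
proof (induction k)
  case (Suc k)
  show ?case
  proof (cases "j + 2 \<le> i + k")
    case True
    have "T_op N t j (ch (Suc k)) = T_op N t (i + k) (T_op N t j (ch k))"
      using Suc.prems True i T_op_far_commute[of j "i + k" N t "ch k"] by simp
    then show ?thesis using Suc True by (simp add: T_op_fscale)
  next
    case False
    define l where "l = k - 1"
    have k: "k = Suc l" and j: "j = i + l"
      using Suc.prems False by (simp_all add: l_def)
    have "T_op N t j (ch (Suc k)) = T_op N t (Suc j) (T_op N t j (T_op N t (Suc j) (ch l)))"
      using T_op_braid[of j N t "ch l"] Suc.prems i by (simp add: k j)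
    also have "T_op N t (Suc j) (ch l) = fscale t (ch l)"
      using Suc.prems by (intro chain_far) (auto simp: k j)
    finally show ?thesis by (simp add: T_op_fscale k j)
  qed
qed simp

lemma chain_down:
  "i + k < N \<Longrightarrow> T_op N t (i + k) (ch (Suc k)) = fscale (t - 1) (ch (Suc k)) + fscale t (ch k)"
  using T_op_quadratic[OF _ _ supported_chain[of k], of "i + k" t] i by simp

text \<open>\<open>T\<^sub>j\<close> multiplies all vectors of the chain by \<open>t\<close> except two neighbours, and on those the quadratic relation makes the sum an eigenvector.\<close>

lemma chain_sum_invariant:
  assumes j: "i \<le> j" "j < N"
  shows "T_op N t j (\<Sum>k\<le>N - i. ch k) = fscale t (\<Sum>k\<le>N - i. ch k)"
proof -
  obtain k where jk: "j = i + k" using j le_Suc_ex by blast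
  let ?d = "\<lambda>l. T_op N t j (ch l) - fscale t (ch l)"
  have "?d l = 0" if "l \<noteq> k" "l \<noteq> Suc k" "l \<le> N - i" for l
  proof (cases "l < k")
    case True
    then show ?thesis using chain_far[of l j] j jk by simp
  next
    case False
    then show ?thesis using chain_near[of j l] j jk that by simp
  qed
  then have "(\<Sum>l\<le>N - i. ?d l) = (\<Sum>l\<in>{k, Suc k}. ?d l)"
    using j jk by (intro sum.mono_neutral_right) auto
  also have "\<dots> = 0"
    using chain_down[of k] j
    by (auto simp: jk fun_eq_iff fscale_def algebra_simps)
  finally show ?thesis
    by (simp add: T_op_sum fun_eq_iff fun_sum_apply fscale_def sum_subtractf sum_distrib_left)
qed

text \<open>The recursion for \<open>\<omega>\<close> is unwound from \<open>\<omega>\<^sub>N = 1\<close> downwards: each step applies \<open>T\<^bsub>i+k\<^esub>\<close>, which scales the later vectors of the chain by \<open>t\<close> and sends the next one back by the quadratic relation.\<close>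

lemma omega_chain:
  assumes t: "t \<noteq> 0" and k: "i + k \<le> N"
  shows "omega N t (i + k) (ch k) = ch k + fscale (1 - inverse t) (\<Sum>l\<in>{k<..N - i}. ch l)"
  using k
proof (induction "N - (i + k)" arbitrary: k)
  case 0
  then have "i + k = N" by simp
  then show ?case
    by (subst omega.simps) (auto simp: fun_eq_iff fscale_def)
next
  case (Suc d)
  then have k: "i + k < N" by simp
  have IH: "omega N t (i + Suc k) (ch (Suc k)) =
      ch (Suc k) + fscale (1 - inverse t) (\<Sum>l\<in>{Suc k<..N - i}. ch l)"
    using Suc by (intro Suc.hyps(1)) auto
  have "T_op N t (i + k) (\<Sum>l\<in>{Suc k<..N - i}. ch l) = (\<Sum>l\<in>{Suc k<..N - i}. fscale t (ch l))"
    unfolding T_op_sum using k by (intro sum.cong refl chain_near) auto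
  moreover have "{k<..N - i} = insert (Suc k) {Suc k<..N - i}"
    using k by auto
  moreover have "omega N t (i + k) (ch k) =
      fscale (inverse t) (T_op N t (i + k) (omega N t (i + Suc k) (ch (Suc k))))"
    using k by (subst omega.simps) simp
  ultimately have "omega N t (i + k) (ch k) = fscale (inverse t)
      (fscale (t - 1) (ch (Suc k)) + fscale t (ch k)
        + fscale (1 - inverse t) (\<Sum>l\<in>{Suc k<..N - i}. fscale t (ch l)))"
    unfolding IH T_op_add T_op_fscale chain_down[OF k] by simp
  also have "\<dots> = ch k + fscale (1 - inverse t) (\<Sum>l\<in>insert (Suc k) {Suc k<..N - i}. ch l)"
    using t by (simp add: fun_eq_iff fscale_def fun_sum_apply field_simps sum_distrib_left[symmetric]
        del: chain.simps)
  finally show ?case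
    using \<open>{k<..N - i} = _\<close> by simp
qed

end

text \<open>The contribution of \<open>\<omega>\<^sub>i\<close> beyond a multiple of \<open>f\<close> is invariant under one more operator. This is what links content eigenvalues with invariance.\<close>

lemma omega_eq_chain_sum:
  fixes t :: "'k::field"
  assumes "1 \<le> i" "i \<le> N" "supported N m f" "t \<noteq> 0"
    and "\<And>j. i < j \<Longrightarrow> j < N \<Longrightarrow> T_op N t j f = fscale t f"
  shows "omega N t i f = fscale (inverse t) f + fscale (1 - inverse t) (\<Sum>k\<le>N - i. chain N t i f k)"
proof -
  have "{..N - i} = insert 0 {0<..N - i}" by auto
  then show ?thesis
    using omega_chain[OF assms(1-3,5), of 0] assms(2,4)
    by (simp add: fun_eq_iff fscale_def fun_sum_apply algebra_simps)
qed

section \<open>Partially symmetric vectors in the kernel of D\<close>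

text \<open>On coefficients, invariance under \<open>T\<^sub>i\<close> is plain invariance under \<open>s\<^sub>i\<close> together with vanishing where both letters occur; the parameter \<open>t\<close> disappears.\<close>

lemma T_op_eq_scale_iff:
  fixes t :: "'r::idom"
  assumes "1 \<le> i" "i < N" "supported N m f" "t \<noteq> - 1" "t \<noteq> 0"
  shows "T_op N t i f = fscale t f \<longleftrightarrow>
    (\<forall>E. (i \<in> E \<and> Suc i \<in> E \<longrightarrow> f E = 0) \<and> (i \<in> E \<and> Suc i \<notin> E \<longrightarrow> f (swap_set i E) = f E))"
proof -
  have mem: "i \<in> swap_set i E \<longleftrightarrow> Suc i \<in> E" "Suc i \<in> swap_set i E \<longleftrightarrow> i \<in> E" for E
    by (simp_all add: in_transpose_image_iff)
  have ss: "swap_set i (swap_set i E) = E" for E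
    by (simp add: image_comp)
  have neg: "- f E = t * f E \<longleftrightarrow> f E = 0" for E
  proof -
    have "- f E = t * f E \<longleftrightarrow> (t + 1) * f E = 0"
      by (simp add: neg_eq_iff_add_eq_0 algebra_simps)
    then show ?thesis using assms(4) by (simp add: eq_neg_iff_add_eq_0)
  qed
  have supp: "f E = 0" "f (swap_set i E) = 0" if "\<not> E \<subseteq> {1..N}" for E
    using that assms(3) swap_set_subset[OF assms(1,2), of E] by (auto simp: supported_def)
  show ?thesis
  proof (intro iffI allI)
    fix E assume "T_op N t i f = fscale t f"
    then have "T_op N t i f E = t * f E"
      by (simp add: fscale_def)
    then show "(i \<in> E \<and> Suc i \<in> E \<longrightarrow> f E = 0) \<and> (i \<in> E \<and> Suc i \<notin> E \<longrightarrow> f (swap_set i E) = f E)"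
      using assms(5) supp[of E] by (auto simp: T_op_apply[OF assms(1,2)] neg split: if_splits)
  next
    assume *: "\<forall>E. (i \<in> E \<and> Suc i \<in> E \<longrightarrow> f E = 0) \<and> (i \<in> E \<and> Suc i \<notin> E \<longrightarrow> f (swap_set i E) = f E)"
    show "T_op N t i f = fscale t f"
    proof
      fix E
      show "T_op N t i f E = fscale t f E"
        using *[rule_format, of E] *[rule_format, of "swap_set i E"] supp(1)[of E]
        by (auto simp: T_op_apply[OF assms(1,2)] fscale_def mem ss algebra_simps)
    qed
  qed
qed

definition sym_above :: "nat \<Rightarrow> nat \<Rightarrow> 'r::comm_ring_1 \<Rightarrow> 'r ferm \<Rightarrow> bool" where
  "sym_above N n t f \<longleftrightarrow> (\<forall>j. n < j \<and> j < N \<longrightarrow> T_op N t j f = fscale t f)"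

lemma sym_above_move:
  fixes t :: "'r::idom"
  assumes "supported N m f" "sym_above N n t f" "t \<noteq> - 1" "t \<noteq> 0"
    and "n < k" "k \<le> l" "l \<le> N" "A \<inter> {n<..N} = {}"
  shows "f (insert l A) = f (insert k A)"
  using assms(6,7)
proof (induction l rule: dec_induct)
  case (step l)
  have "l \<notin> A" "Suc l \<notin> A" using assms(5,8) step by auto
  then have swap: "swap_set l (insert l A) = insert (Suc l) A" by simp
  have T: "T_op N t l f = fscale t f" "1 \<le> l" "l < N"
    using assms(2,5) step by (auto simp: sym_above_def)
  have "f (swap_set l (insert l A)) = f (insert l A)"
    using T_op_eq_scale_iff[OF T(2,3) assms(1,3,4), THEN iffD1, OF T(1), rule_format, of "insert l A"]
      \<open>Suc l \<notin> A\<close> by simp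
  then show ?case using step swap by simp
qed simp

text \<open>The larger of the two elements is moved down until they are neighbours.\<close>

lemma sym_above_two:
  fixes t :: "'r::idom"
  assumes "supported N m f" "sym_above N n t f" "t \<noteq> - 1" "t \<noteq> 0"
    and "n < k" "k < l" "l \<le> N" "k \<in> E" "l \<in> E"
  shows "f E = 0"
proof -
  have "\<forall>E. k \<in> E \<longrightarrow> l \<in> E \<longrightarrow> f E = 0"
    using assms(6,7)
  proof (induction l rule: less_induct)
    case (less l)
    show ?case
    proof (intro allI impI)
      fix E assume E: "k \<in> E" "l \<in> E"
      obtain l' where l: "l = Suc l'" "k \<le> l'" using less.prems by (cases l) auto
      have T: "T_op N t l' f = fscale t f" "1 \<le> l'" "l' < N"
        using assms(2,5) l less.prems by (auto simp: sym_above_def)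
      note * = T_op_eq_scale_iff[OF T(2,3) assms(1,3,4), THEN iffD1, OF T(1), rule_format]
      show "f E = 0"
      proof (cases "l' \<in> E")
        case True
        then show ?thesis using * E l by blast
      next
        case False
        then have kl: "k < l'" using E l by (cases "k = l'") auto
        let ?E = "swap_set l' E"
        have "l' \<in> ?E" "Suc l' \<notin> ?E" "k \<in> ?E"
          using False E l kl by (simp_all add: in_transpose_image_iff)
        moreover have "f ?E = 0"
          using less.IH[of l'] l kl less.prems calculation by auto
        ultimately show ?thesis
          using *[of ?E] by (simp add: image_comp)
      qed
    qed
  qed
  then show ?thesis using assms by blast
qed

text \<open>The coefficient of \<open>D f\<close> at \<open>{1..m} - {l}\<close> involves \<open>f\<close> at \<open>{1..m}\<close> and at the sets in which \<open>l\<close> is replaced by some \<open>k > m\<close>; on the latter \<open>f\<close> takes a single value.\<close>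

lemma sym_above_D_kernel_eq:
  fixes t :: "'r::idom"
  assumes "supported N m f" "sym_above N m t f" "t \<noteq> - 1" "t \<noteq> 0" "m < N"
    and "D_op N t f = 0" "l \<in> {1..m}"
  shows "D_coeff t ({1..m} - {l}) l * f {1..m} +
    (\<Sum>k\<in>{m<..N}. t ^ (k - 1)) * (- 1) ^ (m - 1) * f (insert N ({1..m} - {l})) = 0"
proof -
  let ?G = "{1..m} - {l}"
  have I: "{1..N} - ?G = insert l {m<..N}" using assms(5,7) by auto
  have ins: "insert l ?G = {1..m}" using assms(7) by auto
  have "?G \<subseteq> {1..N}" using assms(5) by auto
  have "0 = D_op N t f ?G" using assms(6) by simp
  also have "\<dots> = D_coeff t ?G l * f {1..m} + (\<Sum>k\<in>{m<..N}. D_coeff t ?G k * f (insert k ?G))"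
    using assms(5,7) ins \<open>?G \<subseteq> {1..N}\<close> by (simp add: D_op_apply I del: One_nat_def)
  also have "(\<Sum>k\<in>{m<..N}. D_coeff t ?G k * f (insert k ?G)) =
      (\<Sum>k\<in>{m<..N}. t ^ (k - 1) * (- 1) ^ (m - 1) * f (insert N ?G))"
  proof (intro sum.cong refl)
    fix k assume k: "k \<in> {m<..N}"
    have "{j \<in> ?G. j < k} = ?G" using k by auto
    then have "D_coeff t ?G k = t ^ (k - 1) * (- 1) ^ (m - 1)"
      using assms(7) by (simp add: D_coeff_def)
    moreover have "f (insert N ?G) = f (insert k ?G)"
      using k by (intro sym_above_move[OF assms(1-4)]) auto
    ultimately show "D_coeff t ?G k * f (insert k ?G) = t ^ (k - 1) * (- 1) ^ (m - 1) * f (insert N ?G)"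
      by simp
  qed
  finally show ?thesis by (simp add: sum_distrib_right)
qed

text \<open>Invariance leaves only the sets \<open>{1..m}\<close> and \<open>({1..m} - {l}) \<union> {k}\<close>, and the coefficients at the latter are determined by the one at \<open>{1..m}\<close>. This is the one-dimensionality of the space of invariants; the domain of coefficients is kept general because it is used both for \<open>K\<close> and for \<open>K[x]\<close>.\<close>

lemma sym_above_D_kernel_unique:
  fixes t :: "'r::idom"
  assumes "supported N m f" "sym_above N m t f" "t \<noteq> - 1" "t \<noteq> 0" "m < N"
    and "D_op N t f = 0" "f {1..m} = 0" "(\<Sum>k\<in>{m<..N}. t ^ (k - 1)) \<noteq> 0"
  shows "f = 0"
proof
  fix E
  show "f E = 0 E"
  proof (rule ccontr)
    assume nz: "f E \<noteq> 0 E"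
    then have E: "E \<subseteq> {1..N}" "card E = m" using assms(1) by (auto simp: supported_def)
    have finE: "finite E" using E(1) finite_subset by blast
    have "E \<noteq> {1..m}" using nz assms(7) by auto
    then have "\<not> E \<subseteq> {1..m}" using E(2) card_subset_eq[of "{1..m}" E] by auto
    then obtain k where k: "k \<in> E" "m < k" "k \<le> N" using E(1) by (auto simp: subset_iff not_le)
    have "l = k" if "l \<in> E" "m < l" for l
      using sym_above_two[OF assms(1-4), of l k E] sym_above_two[OF assms(1-4), of k l E] that k nz E(1)
      by (cases l k rule: linorder_cases) auto
    then have sub: "E - {k} \<subseteq> {1..m}" using E(1) by (auto simp: subset_iff not_le[symmetric])
    have "card (E - {k}) < card {1..m}"
      using E(2) k(1) finE card_Diff1_less[of E k] by simp
    then obtain l where l: "l \<in> {1..m}" "l \<notin> E - {k}"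
      using sub by (metis less_irrefl subsetI subset_antisym)
    have eq: "E - {k} = {1..m} - {l}"
      using sub l E(2) k(1) finE by (intro card_subset_eq) auto
    have "f (insert N ({1..m} - {l})) = 0"
      using sym_above_D_kernel_eq[OF assms(1-6) l(1)] assms(7,8) by auto
    moreover have "f (insert N ({1..m} - {l})) = f (insert k ({1..m} - {l}))"
      using k by (intro sym_above_move[OF assms(1-4)]) auto
    moreover have "E = insert k ({1..m} - {l})" using eq k(1) by auto
    ultimately show False using nz by simp
  qed
qed

text \<open>With \<open>m\<close> among the exchangeable letters, the coefficient at \<open>{1..m}\<close> agrees with the one at \<open>({1..m} - {m}) \<union> {N}\<close>, and the kernel equation reads \<open>(t\<^bsup>m-1\<^esup> + \<dots> + t\<^bsup>N-1\<^esup>) f({1..m}) = 0\<close>.\<close>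

lemma sym_from_m_D_kernel_zero:
  fixes t :: "'r::idom"
  assumes "supported N m f" "1 \<le> m" "sym_above N (m - 1) t f" "t \<noteq> - 1" "t \<noteq> 0" "m < N"
    and "D_op N t f = 0" "(\<Sum>k\<in>{m<..N}. t ^ (k - 1)) \<noteq> 0" "(\<Sum>k\<in>{m..N}. t ^ (k - 1)) \<noteq> 0"
  shows "f = 0"
proof -
  have sym: "sym_above N m t f" using assms(3) by (auto simp: sym_above_def)
  let ?G = "{1..m} - {m}"
  have ins: "insert m ?G = {1..m}" using assms(2) by auto
  have "f (insert N ?G) = f (insert m ?G)"
    using assms(2,6) by (intro sym_above_move[OF assms(1,3,4,5)]) auto
  then have "f (insert N ?G) = f {1..m}" by (simp only: ins)
  moreover have "{j \<in> ?G. j < m} = ?G" by auto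
  then have "D_coeff t ?G m = t ^ (m - 1) * (- 1) ^ (m - 1)"
    using assms(2) by (simp add: D_coeff_def)
  ultimately have "(- 1) ^ (m - 1) * ((t ^ (m - 1) + (\<Sum>k\<in>{m<..N}. t ^ (k - 1))) * f {1..m}) = 0"
    using sym_above_D_kernel_eq[OF assms(1) sym assms(4-7), of m] assms(2)
    by (simp add: algebra_simps)
  moreover have "{m..N} = insert m {m<..N}" using assms(6) by auto
  ultimately have "f {1..m} = 0" using assms(9) by simp
  then show ?thesis
    using sym_above_D_kernel_unique[OF assms(1) sym assms(4-7)] assms(8) by simp
qed

section \<open>Coordinates with respect to the vectors psi\<close>

lemma supported_alt: "supported N m f \<longleftrightarrow> (\<forall>E. \<not> (E \<subseteq> {1..N} \<and> card E = m) \<longrightarrow> f E = 0)"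
  by (auto simp: supported_def)

lemma supported_0: "supported N m 0"
  by (simp add: supported_def)

lemma supported_add: "supported N m f \<Longrightarrow> supported N m g \<Longrightarrow> supported N m (f + g)"
  by (simp add: supported_alt)

lemma supported_fscale: "supported N m f \<Longrightarrow> supported N m (fscale c f)"
  by (simp add: supported_alt fscale_def)

lemma supported_diff: "supported N m f \<Longrightarrow> supported N m g \<Longrightarrow> supported N m (f - g)"
  by (simp add: supported_alt)

lemma supported_sum: "(\<And>i. i \<in> A \<Longrightarrow> supported N m (f i)) \<Longrightarrow> supported N m (sum f A)"
  by (simp add: supported_alt fun_sum_apply)

lemma sum_fscale_phi:
  assumes "finite S" "\<And>E. f E \<noteq> 0 \<Longrightarrow> E \<in> S"
  shows "(\<Sum>E\<in>S. fscale (f E) (phi E)) = f"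
proof
  fix G
  have "(\<Sum>E\<in>S. fscale (f E) (phi E)) G = (\<Sum>E\<in>S. if G = E then f E else 0)"
    by (simp add: fun_sum_apply fscale_def phi_def if_distrib cong: if_cong)
  also have "\<dots> = f G"
    using assms by (auto simp: sum.delta')
  finally show "(\<Sum>E\<in>S. fscale (f E) (phi E)) G = f G" .
qed

lemma Pm_iff: "f \<in> Pm N m \<longleftrightarrow> supported N m f"
proof
  interpret module "fscale :: 'a \<Rightarrow> 'a ferm \<Rightarrow> 'a ferm" by (rule module_fscale)
  {
    assume "f \<in> Pm N m"
    then have "f \<in> span {phi E | E. E \<subseteq> {1..N} \<and> card E = m}" by (simp add: Pm_def)
    then show "supported N m f"
    proof (induction rule: span_induct_alt)
      case base
      show ?case by (rule supported_0)
    next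
      case (step c x y)
      then show ?case
        by (intro supported_add supported_fscale) (auto simp: supported_def phi_def split: if_splits)
    qed
  }
  {
    assume supp: "supported N m f"
    have "(\<Sum>E\<in>{E\<in>Pow {1..N}. card E = m}. fscale (f E) (phi E)) \<in> Pm N m"
      unfolding Pm_def by (intro span_sum span_scale span_base) auto
    moreover have "(\<Sum>E\<in>{E\<in>Pow {1..N}. card E = m}. fscale (f E) (phi E)) = f"
      using supp by (intro sum_fscale_phi) (auto simp: supported_def)
    ultimately show "f \<in> Pm N m" by simp
  }
qed

lemma Pm0_iff: "f \<in> Pm0 N t m \<longleftrightarrow> supported N m f \<and> D_op N t f = 0"
  by (simp add: Pm0_def Pm_iff)

text \<open>The argument of \<open>D\<close> is the product \<open>f \<theta>\<^sub>N\<close>, written without signs because \<open>N\<close> is the largest index. Up to a scalar, multiplication by \<open>\<theta>\<^sub>N\<close> is a contracting homotopy for \<open>D\<close>.\<close>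

lemma theta_N_homotopy:
  assumes "supported N m f" "D_op N t f = 0" "1 \<le> N"
  shows "D_op N t (\<lambda>G. if N \<in> G then f (G - {N}) else 0) = fscale ((- 1) ^ m * t ^ (N - 1)) f"
    (is "D_op N t ?u = _")
proof
  fix G
  show "D_op N t ?u G = fscale ((- 1) ^ m * t ^ (N - 1)) f G"
  proof (cases "G \<subseteq> {1..N}")
    case False
    then show ?thesis using supportedD[OF assms(1), of G] by (auto simp: D_op_apply fscale_def)
  next
    case True
    then have fin: "finite G" by (rule finite_subset) simp
    have coeff: "D_coeff t (G - {N}) N = t ^ (N - 1) * (- 1) ^ card (G - {N})"
    proof -
      have "{j \<in> G - {N}. j < N} = G - {N}" using True by auto
      then show ?thesis by (simp add: D_coeff_def)
    qed
    show ?thesis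
    proof (cases "N \<in> G")
      case False
      have "D_op N t ?u G = (\<Sum>i\<in>{1..N} - G. D_coeff t G i * ?u (insert i G))"
        using True by (simp add: D_op_apply)
      also have "\<dots> = (\<Sum>i\<in>{N}. D_coeff t G i * ?u (insert i G))"
        using False assms(3) by (intro sum.mono_neutral_right) auto
      also have "\<dots> = t ^ (N - 1) * (- 1) ^ card G * f G"
        using False coeff by simp
      also have "\<dots> = fscale ((- 1) ^ m * t ^ (N - 1)) f G"
        using supportedD[OF assms(1), of G] by (cases "card G = m") (auto simp: fscale_def)
      finally show ?thesis .
    next
      case N: True
      let ?H = "G - {N}"
      have I: "{1..N} - ?H = insert N ({1..N} - G)" using N assms(3) by auto
      have H: "?H \<subseteq> {1..N}" using True by auto
      have ins: "insert N ?H = G" using N by auto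
      have eq: "D_coeff t ?H i * f (insert i ?H) = D_coeff t G i * ?u (insert i G)"
        if "i \<in> {1..N} - G" for i
      proof -
        have "{j \<in> ?H. j < i} = {j \<in> G. j < i}" "insert i G - {N} = insert i ?H"
          using that N by auto
        then show ?thesis using N by (simp add: D_coeff_def)
      qed
      have "0 = D_op N t f ?H" using assms(2) by simp
      also have "\<dots> = (\<Sum>i\<in>insert N ({1..N} - G). D_coeff t ?H i * f (insert i ?H))"
        using H by (simp add: D_op_apply I del: One_nat_def)
      also have "\<dots> = D_coeff t ?H N * f G + (\<Sum>i\<in>{1..N} - G. D_coeff t ?H i * f (insert i ?H))"
        using N ins by (subst sum.insert) auto
      also have "(\<Sum>i\<in>{1..N} - G. D_coeff t ?H i * f (insert i ?H)) = D_op N t ?u G"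
        using True by (simp add: D_op_apply eq del: One_nat_def)
      finally have 1: "D_op N t ?u G = - (D_coeff t ?H N * f G)"
        by (simp add: eq_neg_iff_add_eq_0 add.commute)
      show ?thesis
      proof (cases "f G = 0")
        case False
        then have "card G = m" using assms(1) by (auto simp: supported_def)
        moreover have "card G = Suc (card ?H)" by (rule card.remove[OF fin N])
        ultimately have "m = Suc (card ?H)" by simp
        then show ?thesis using 1 coeff by (simp add: fscale_def)
      qed (use 1 in \<open>simp add: fscale_def\<close>)
    qed
  qed
qed

text \<open>The explicit expansion of an element of \<open>P\<^bsub>m,0\<^esub>\<close> in the vectors \<open>\<psi>\<^sub>G\<close>, \<open>G \<in> Y\<^sub>0\<close>; the coefficient of \<open>\<psi>\<^sub>G\<close> is read off at \<open>G - {N}\<close>.\<close>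

lemma kernel_eq_sum_psi:
  fixes t :: "'k::field"
  assumes "f \<in> Pm0 N t m" "1 \<le> N"
  shows "fscale ((- 1) ^ m * t ^ (N - 1)) f = (\<Sum>G\<in>Y0 N m. fscale (f (G - {N})) (psi N t G))"
proof -
  have supp: "supported N m f" "D_op N t f = 0" using assms(1) by (auto simp: Pm0_iff)
  let ?u = "\<lambda>G. if N \<in> G then f (G - {N}) else 0"
  have fin: "finite (Y0 N m)" by (rule finite_subset[of _ "Pow {1..N}"]) (auto simp: Y0_def)
  have "G \<in> Y0 N m" if "?u G \<noteq> 0" for G
  proof -
    have G: "N \<in> G" "f (G - {N}) \<noteq> 0" using that by (auto split: if_splits)
    then have H: "G - {N} \<subseteq> {1..N}" "card (G - {N}) = m" using supp(1) by (auto simp: supported_def)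
    then have "finite G" using finite_subset[of "G - {N}" "{1..N}"] by simp
    then have "card G = m + 1" using card.remove[of G N] H(2) G(1) by simp
    then show ?thesis using G(1) H(1) assms(2) by (auto simp: Y0_def)
  qed
  then have "?u = (\<Sum>G\<in>Y0 N m. fscale (?u G) (phi G))"
    using sum_fscale_phi[OF fin, of ?u] by simp
  also have "\<dots> = (\<Sum>G\<in>Y0 N m. fscale (f (G - {N})) (phi G))"
    by (intro sum.cong refl) (simp add: Y0_def)
  finally have "D_op N t ?u = (\<Sum>G\<in>Y0 N m. fscale (f (G - {N})) (psi N t G))"
    by (simp add: D_op_sum D_op_fscale psi_def)
  then show ?thesis
    using theta_N_homotopy[OF supp assms(2)] by simp
qed

context
  fixes N m :: nat and F :: "nat set"
  assumes m_less: "m < N" and F: "F = {1..m} \<union> {N}"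
begin

lemma F_in_Y0: "F \<in> Y0 N m"
proof -
  have "F = insert N {1..m}" by (auto simp: F)
  then show ?thesis using m_less by (auto simp: Y0_def)
qed

lemma Y0_cases:
  assumes "G \<in> Y0 N m" "G - {N} \<noteq> {1..m}"
  obtains i j where "i \<in> G" "i \<noteq> N" "m < i" "j \<in> {1..m}" "j \<notin> G"
proof -
  have G: "G \<subseteq> {1..N}" "card G = m + 1" "N \<in> G" "finite G"
    using assms(1) finite_subset[of G "{1..N}"] by (auto simp: Y0_def)
  then have c: "card (G - {N}) = m" by simp
  have "\<not> G - {N} \<subseteq> {1..m}"
    using card_subset_eq[of "{1..m}" "G - {N}"] c assms(2) by auto
  moreover have "\<not> {1..m} \<subseteq> G - {N}"
    using card_subset_eq[of "G - {N}" "{1..m}"] c G(4) assms(2) by auto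
  ultimately obtain i j where ij: "i \<in> G - {N}" "i \<notin> {1..m}" "j \<in> {1..m}" "j \<notin> G - {N}"
    by blast
  then have "m < i" "j \<notin> G"
    using G(1) m_less by auto
  then show thesis using that ij by blast
qed

lemma invs_F: "invs N F = m * (N - 1 - m)"
proof -
  have "{(i, j). i \<in> F \<and> j \<in> {1..N} - F \<and> i < j} = {1..m} \<times> {m<..<N}"
    using m_less by (auto simp: F)
  then show ?thesis by (simp add: invs_def card_cartesian_product)
qed

text \<open>Only the \<open>m (N - 1 - m)\<close> pairs in \<open>(G - {N}) \<times> G\<^sup>C\<close> can count, and all of them do for \<open>G = F\<close> alone. So \<open>F\<close> is the top element, and the triangularity condition allows every other \<open>\<psi>\<^sub>G\<close>.\<close>

lemma invs_less_invs_F: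
  assumes "G \<in> Y0 N m" "G \<noteq> F"
  shows "invs N G < invs N F"
proof -
  have G: "G \<subseteq> {1..N}" "card G = m + 1" "N \<in> G" "finite G"
    using assms(1) finite_subset[of G "{1..N}"] by (auto simp: Y0_def)
  have "G - {N} \<noteq> {1..m}" using assms(2) G(3) by (auto simp: F)
  then obtain i j where ij: "i \<in> G" "i \<noteq> N" "m < i" "j \<in> {1..m}" "j \<notin> G"
    using Y0_cases assms(1) by metis
  have "{(i, j). i \<in> G \<and> j \<in> {1..N} - G \<and> i < j} \<subset> (G - {N}) \<times> ({1..N} - G)"
  proof
    show "{(i, j). i \<in> G \<and> j \<in> {1..N} - G \<and> i < j} \<subseteq> (G - {N}) \<times> ({1..N} - G)" by auto
    have "(i, j) \<in> (G - {N}) \<times> ({1..N} - G)" "(i, j) \<notin> {(i, j). i \<in> G \<and> j \<in> {1..N} - G \<and> i < j}"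
      using ij m_less by auto
    then show "{(i, j). i \<in> G \<and> j \<in> {1..N} - G \<and> i < j} \<noteq> (G - {N}) \<times> ({1..N} - G)" by metis
  qed
  then have "invs N G < card ((G - {N}) \<times> ({1..N} - G))"
    unfolding invs_def by (intro psubset_card_mono) (use G in auto)
  also have "\<dots> = m * (N - 1 - m)"
    using G by (simp add: card_cartesian_product card_Diff_subset)
  finally show ?thesis by (simp add: invs_F)
qed

lemma psi_at_first:
  assumes "G \<in> Y0 N m"
  shows "psi N t G {1..m} = (if G = F then (- 1) ^ m * t ^ (N - 1) else 0)"
proof -
  have "psi N t G {1..m} = (\<Sum>i\<in>{1..N} - {1..m}. D_coeff t {1..m} i * phi G (insert i {1..m}))"
    using m_less by (simp add: psi_def D_op_apply)
  also have "\<dots> = (\<Sum>i\<in>{N}. D_coeff t {1..m} i * phi G (insert i {1..m}))"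
    using m_less assms by (intro sum.mono_neutral_right) (auto simp: phi_def Y0_def)
  also have "{j \<in> {1..m}. j < N} = {1..m}" using m_less by auto
  then have "(\<Sum>i\<in>{N}. D_coeff t {1..m} i * phi G (insert i {1..m})) =
      (if G = F then (- 1) ^ m * t ^ (N - 1) else 0)"
    by (auto simp: D_coeff_def phi_def F)
  finally show ?thesis .
qed

text \<open>Since \<open>\<psi>\<^sub>F\<close> is the only one among the \<open>\<psi>\<^sub>G\<close> with a nonzero coefficient at \<open>{1..m}\<close>, and the coefficients of the expansion are known, the leading term condition is a normalization of one coefficient.\<close>

lemma triangular_iff:
  fixes t :: "'k::field"
  assumes "f \<in> Pm0 N t m" "t \<noteq> 0"
  shows "f - fscale (t ^ invs N F) (psi N t F)
      \<in> module.span fscale {psi N t G | G. G \<in> Y0 N m \<and> invs N G < invs N F}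
    \<longleftrightarrow> f {1..m} = (- 1) ^ m * t ^ (N - 1 + invs N F)" (is "?h \<in> _ \<longleftrightarrow> _")
proof
  interpret module "fscale :: 'k \<Rightarrow> 'k ferm \<Rightarrow> 'k ferm" by (rule module_fscale)
  {
    assume "?h \<in> span {psi N t G | G. G \<in> Y0 N m \<and> invs N G < invs N F}"
    then have "?h {1..m} = 0"
    proof (induction rule: span_induct_alt)
      case (step c x y)
      then obtain G where "x = psi N t G" "G \<in> Y0 N m" "G \<noteq> F" by auto
      then show ?case using step by (simp add: fscale_def psi_at_first del: One_nat_def)
    qed simp
    then show "f {1..m} = (- 1) ^ m * t ^ (N - 1 + invs N F)"
      using psi_at_first[OF F_in_Y0, of t] by (simp add: fscale_def power_add mult_ac)
  }
  {
    assume val: "f {1..m} = (- 1) ^ m * t ^ (N - 1 + invs N F)"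
    define c where "c = (- 1) ^ m * t ^ (N - 1)"
    have c: "c \<noteq> 0" using assms(2) by (simp add: c_def)
    have sq: "(- 1) ^ m * (- 1) ^ m = (1 :: 'k)" by (simp flip: power_add mult_2)
    have fin: "finite (Y0 N m)" by (rule finite_subset[of _ "Pow {1..N}"]) (auto simp: Y0_def)
    have FN: "F - {N} = {1..m}" using m_less by (auto simp: F)
    have "fscale c f = fscale (f (F - {N})) (psi N t F)
        + (\<Sum>G\<in>Y0 N m - {F}. fscale (f (G - {N})) (psi N t G))"
      unfolding c_def using kernel_eq_sum_psi[OF assms(1)] m_less F_in_Y0 fin
      by (simp add: sum.remove)
    moreover have "f (F - {N}) = c * t ^ invs N F"
      unfolding FN val c_def by (simp add: power_add)
    ultimately have "?h = fscale (inverse c) (\<Sum>G\<in>Y0 N m - {F}. fscale (f (G - {N})) (psi N t G))"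
      using c by (simp add: fun_eq_iff fscale_def field_simps)
    also have "\<dots> \<in> span {psi N t G | G. G \<in> Y0 N m \<and> invs N G < invs N F}"
      using invs_less_invs_F by (intro span_scale span_sum span_base) auto
    finally show "?h \<in> span {psi N t G | G. G \<in> Y0 N m \<and> invs N G < invs N F}" .
  }
qed

section \<open>The hook tableau of F\<close>

lemma nth_elem_F: "1 \<le> k \<Longrightarrow> k \<le> m + 1 \<Longrightarrow> nth_elem F k = (if k \<le> m then k else N)"
proof -
  assume k: "1 \<le> k" "k \<le> m + 1"
  have "F = set ([1..<Suc m] @ [N])" by (auto simp: F)
  moreover have "sorted ([1..<Suc m] @ [N])" "distinct ([1..<Suc m] @ [N])"
    using m_less by (auto simp: sorted_append)
  ultimately have "sorted_list_of_set F = [1..<Suc m] @ [N]"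
    by (metis sorted_list_of_set.idem_if_sorted_distinct)
  then show ?thesis
    using k by (auto simp: nth_elem_def nth_append)
qed

lemma nth_elem_compl_F: "1 \<le> k \<Longrightarrow> k < N - m \<Longrightarrow> nth_elem ({1..N} - F) k = m + k"
proof -
  assume k: "1 \<le> k" "k < N - m"
  have "{1..N} - F = set [Suc m..<N]" using m_less by (auto simp: F)
  then have "sorted_list_of_set ({1..N} - F) = [Suc m..<N]"
    by (metis sorted_list_of_set.idem_if_sorted_distinct sorted_upt distinct_upt)
  then show ?thesis
    using k by (auto simp: nth_elem_def)
qed

lemma hook_tab_F:
  assumes "(a, b) \<in> hook_cells N m"
  shows "hook_tab N m F a b = (if a = 1 then N + 1 - b else m + 2 - a)"
  using assms m_less
  by (auto simp: hook_cells_def hook_tab_def nth_elem_F nth_elem_compl_F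
    simp del: One_nat_def)

text \<open>In \<open>Y\<^sub>F\<close> the first row contains \<open>N, N - 1, \<dots>, m + 1\<close> and the first column \<open>N, m, m - 1, \<dots>, 1\<close>.\<close>

lemma content_F:
  assumes "i \<in> {1..N}"
  shows "content N m F i = (if i \<le> m then int i - int m - 1 else int N - int i)"
proof -
  define a b where "a = (if i \<le> m then m + 2 - i else 1)" and "b = (if i \<le> m then 1 else N + 1 - i)"
  have ab: "(a, b) \<in> hook_cells N m" "hook_tab N m F a b = i"
    using assms m_less by (auto simp: a_def b_def hook_cells_def hook_tab_def nth_elem_F nth_elem_compl_F
    simp del: One_nat_def)
  have c: "int b - int a = (if i \<le> m then int i - int m - 1 else int N - int i)"
    using assms by (auto simp: a_def b_def)
  have "a' = a \<and> b' = b" if "(a', b') \<in> hook_cells N m" "hook_tab N m F a' b' = i" for a' b'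
    using that(2) m_less assms hook_tab_F[OF that(1)] that(1) unfolding a_def b_def
    by (auto simp: hook_cells_def split: if_splits)
  then show ?thesis
    unfolding content_def c[symmetric] using ab by (intro the_equality) blast+
qed

end

section \<open>Existence and uniqueness of tau\<close>

lemma geometric_sum_nonzero:
  fixes t :: "'k::field"
  assumes "1 \<le> a" "a \<le> b" "t \<noteq> 0" "\<And>k. 0 < k \<Longrightarrow> t ^ k \<noteq> 1"
  shows "(\<Sum>k\<in>{a..b}. t ^ (k - 1)) \<noteq> 0"
proof
  assume 0: "(\<Sum>k\<in>{a..b}. t ^ (k - 1)) = 0"
  have "(t - 1) * (\<Sum>k\<in>{a..b}. t ^ (k - 1)) = t ^ b - t ^ (a - 1)"
    using assms(2)
  proof (induction b rule: dec_induct)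
    case base
    then show ?case using assms(1) by (cases a) (simp_all add: algebra_simps)
  next
    case (step b)
    then have "{a..Suc b} = insert (Suc b) {a..b}" by auto
    then show ?case using step by (simp add: algebra_simps)
  qed
  moreover have "t ^ b = t ^ (a - 1) * t ^ (b + 1 - a)"
    using assms(1,2) by (simp flip: power_add)
  ultimately have "t ^ (a - 1) * (t ^ (b + 1 - a) - 1) = 0"
    using 0 by (simp add: algebra_simps)
  then show False using assms(2,3) assms(4)[of "b + 1 - a"] by simp
qed

lemma T_op_diff: "T_op N t i (f - g) = T_op N t i f - T_op N t i g"
  by (rule ext) (simp add: T_op_def lin_ext_apply algebra_simps sum_subtractf)

lemma D_op_diff: "D_op N t (f - g) = D_op N t f - D_op N t g"
  by (rule ext) (simp add: D_op_apply algebra_simps sum_subtractf)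

lemma sym_above_diff:
  "sym_above N n t f \<Longrightarrow> sym_above N n t g \<Longrightarrow> sym_above N n t (f - g)"
  by (auto simp: sym_above_def T_op_diff fun_eq_iff fscale_def algebra_simps)

lemma omega_fscale: "omega N t i (fscale c f) = fscale c (omega N t i f)"
proof (induction "N - i" arbitrary: i f)
  case 0
  then show ?case by (simp add: omega.simps)
next
  case (Suc n)
  then have "omega N t (Suc i) (fscale c (T_op N t i f)) = fscale c (omega N t (Suc i) (T_op N t i f))"
    by simp
  moreover have i: "i < N" using Suc.hyps(2) by simp
  ultimately have "omega N t i (fscale c f) =
      fscale (inverse t) (fscale c (T_op N t i (omega N t (Suc i) (T_op N t i f))))"
    by (subst omega.simps) (simp add: T_op_fscale)
  moreover have "omega N t i f = fscale (inverse t) (T_op N t i (omega N t (Suc i) (T_op N t i f)))"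
    using i by (subst omega.simps) simp
  ultimately show ?case by (simp add: fscale_def mult_ac)
qed

lemma omega_of_symmetric:
  fixes t :: "'k::field"
  assumes "t \<noteq> 0" "i \<le> N" "\<And>j. i \<le> j \<Longrightarrow> j < N \<Longrightarrow> T_op N t j f = fscale t f"
  shows "omega N t i f = fscale (t ^ (N - i)) f"
  using assms(2,3)
proof (induction "N - i" arbitrary: i)
  case 0
  then show ?case by (simp add: omega.simps fscale_def)
next
  case (Suc n)
  then have i: "i < N" by simp
  have "omega N t (Suc i) f = fscale (t ^ (N - Suc i)) f"
    using Suc by (intro Suc.hyps(1)) auto
  moreover have "N - i = Suc (N - Suc i)" using i by simp
  ultimately show ?case
    using i Suc.prems(2)[of i] assms(1)
    by (subst omega.simps) (simp add: T_op_fscale omega_fscale, simp add: fscale_def field_simps)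
qed

text \<open>With \<open>S\<close> the sum of the chain, \<open>\<omega>\<^sub>i f = t\<^sup>-\<^sup>1 f + (1 - t\<^sup>-\<^sup>1) S\<close>. If \<open>f\<close> is an eigenvector for \<open>t\<^bsup>N-i\<^esup> \<noteq> t\<^sup>-\<^sup>1\<close>, it is a multiple of the invariant vector \<open>S\<close>.\<close>

lemma T_op_of_omega_eigen:
  fixes t :: "'k::field"
  assumes "1 \<le> i" "i < N" "supported N m f" "t \<noteq> 0" "\<And>k. 0 < k \<Longrightarrow> t ^ k \<noteq> 1"
    and "\<And>j. i < j \<Longrightarrow> j < N \<Longrightarrow> T_op N t j f = fscale t f"
    and "omega N t i f = fscale (t ^ (N - i)) f"
  shows "T_op N t i f = fscale t f"
proof -
  let ?S = "\<Sum>k\<le>N - i. chain N t i f k"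
  have t1: "t \<noteq> 1" using assms(5)[of 1] by simp
  \<comment> \<open>The factor of proportionality between the sum of the chain and \<open>f\<close>; it is nonzero because \<open>t\<^bsup>N-i+1\<^esup> \<noteq> 1\<close>.\<close>
  define c where "c = (t ^ (N - i) - inverse t) / (1 - inverse t)"
  have "t ^ (N - i) - inverse t = (t ^ Suc (N - i) - 1) * inverse t"
    using assms(4) by (simp add: field_simps)
  then have c: "c \<noteq> 0"
    using assms(4) assms(5)[of "Suc (N - i)"] t1 by (simp add: c_def field_simps)
  have S: "?S = fscale c f"
  proof
    fix E
    have "t ^ (N - i) * f E = inverse t * f E + (1 - inverse t) * ?S E"
      using omega_eq_chain_sum[OF assms(1) _ assms(3,4,6)] assms(2,7)
      by (simp add: fscale_def fun_eq_iff)
    then have "(1 - inverse t) * ?S E = (t ^ (N - i) - inverse t) * f E"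
      by (simp add: algebra_simps)
    moreover have "1 - inverse t \<noteq> 0" using t1 by simp
    ultimately show "?S E = fscale c f E"
      by (simp add: c_def fscale_def eq_divide_eq mult.commute)
  qed
  have "T_op N t i ?S = fscale t ?S"
    using assms(1,2) by (intro chain_sum_invariant[OF _ _ assms(3,6)]) auto
  then have "fscale c (T_op N t i f) = fscale c (fscale t f)"
    unfolding S T_op_fscale by (simp add: fscale_def fun_eq_iff mult_ac)
  then show ?thesis using c by (simp add: fscale_def fun_eq_iff)
qed

lemma sym_above_of_omega_eigen:
  fixes t :: "'k::field"
  assumes "supported N m f" "t \<noteq> 0" "\<And>k. 0 < k \<Longrightarrow> t ^ k \<noteq> 1"
    and "\<And>i. n < i \<Longrightarrow> i \<le> N \<Longrightarrow> omega N t i f = fscale (t ^ (N - i)) f"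
  shows "sym_above N n t f"
  unfolding sym_above_def
proof (intro allI impI)
  fix j assume "n < j \<and> j < N"
  then show "T_op N t j f = fscale t f"
  proof (induction "N - j" arbitrary: j rule: less_induct)
    case less
    have j: "1 \<le> j" "j < N" using less.prems by auto
    have above: "T_op N t k f = fscale t f" if "j < k" "k < N" for k
      using less that by (intro less.hyps) auto
    show ?case
    proof (rule T_op_of_omega_eigen[OF j assms(1,2)])
      show "omega N t j f = fscale (t ^ (N - j)) f"
        using less.prems by (intro assms(4)) auto
    qed (use assms(3) above in auto)
  qed
qed

text \<open>Here the sum of the chain is invariant under one operator too many and vanishes, which leaves the term \<open>t\<^sup>-\<^sup>1 f\<close>.\<close>

lemma omega_border:
  fixes t :: "'k::field"
  assumes "f \<in> Pm0 N t m" "sym_above N m t f" "1 \<le> m" "m < N" "t \<noteq> 0" "\<And>k. 0 < k \<Longrightarrow> t ^ k \<noteq> 1"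
  shows "omega N t m f = fscale (inverse t) f"
proof -
  let ?S = "\<Sum>k\<le>N - m. chain N t m f k"
  have supp: "supported N m f" "D_op N t f = 0" using assms(1) by (auto simp: Pm0_iff)
  have inv: "T_op N t j f = fscale t f" if "m < j" "j < N" for j
    using assms(2) that by (auto simp: sym_above_def)
  have m: "1 \<le> m" "m \<le> N" using assms(3,4) by auto
  have "D_op N t (chain N t m f k) = 0" if "m + k \<le> N" for k
    using that m(1) supp(2) by (induction k) (simp_all add: D_op_T_op)
  then have D: "D_op N t ?S = 0"
    using m by (simp add: D_op_sum)
  have S: "supported N m ?S"
    using m supported_chain[OF m supp(1) inv] by (intro supported_sum) auto
  have sym: "sym_above N (m - 1) t ?S"
    unfolding sym_above_def using m chain_sum_invariant[OF m supp(1) inv] by auto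
  have "t \<noteq> - 1" using assms(6)[of 2] by auto
  have "{m<..N} = {Suc m..N}" by auto
  then have "(\<Sum>k\<in>{m<..N}. t ^ (k - 1)) \<noteq> 0" "(\<Sum>k\<in>{m..N}. t ^ (k - 1)) \<noteq> 0"
    using geometric_sum_nonzero[of "Suc m" N t] geometric_sum_nonzero[of m N t] assms(3-6) by auto
  then have "?S = 0"
    using sym_from_m_D_kernel_zero[OF S assms(3) sym \<open>t \<noteq> - 1\<close> assms(5,4) D] by blast
  then show ?thesis
    using omega_eq_chain_sum[OF m supp(1) assms(5) inv] by (simp add: fscale_def fun_eq_iff)
qed

text \<open>Below \<open>m\<close> each step of the recursion for \<open>\<omega>\<close> contributes \<open>t\<^sup>-\<^sup>1 (-1)\<^sup>2\<close>.\<close>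

lemma omega_antisymmetric:
  fixes t :: "'k::field"
  assumes "t \<noteq> 0" "i \<le> m" "m < N" "omega N t m f = fscale (inverse t) f"
    and "\<And>j. i \<le> j \<Longrightarrow> j < m \<Longrightarrow> T_op N t j f = - f"
  shows "omega N t i f = fscale (t powi (int i - int m - 1)) f"
  using assms(2,5)
proof (induction i rule: inc_induct)
  case base
  then show ?case using assms(4) by simp
next
  case (step i)
  have neg: "- f = fscale (- 1) f" by (simp add: fun_eq_iff fscale_def)
  have "omega N t i f = fscale (inverse t) (T_op N t i (omega N t (Suc i) (T_op N t i f)))"
    using step.hyps assms(3) by (subst omega.simps) simp
  also have "\<dots> = fscale (inverse t) (fscale (t powi (int (Suc i) - int m - 1)) f)"
    using step by (simp add: neg omega_fscale T_op_fscale) (simp add: fscale_def)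
  also have "t powi (int (Suc i) - int m - 1) = t * t powi (int i - int m - 1)"
    using assms(1) power_int_add_1[of t "int i - int m - 1"] by (simp add: algebra_simps)
  finally show ?case using assms(1) by (simp add: fscale_def fun_eq_iff)
qed

text \<open>The vector \<open>\<Sum>\<^sub>k\<^sub>>\<^sub>m \<phi>\<^bsub>{1..m,k}\<^esub>\<close>: antisymmetric in the first \<open>m\<close> letters, invariant in the others.\<close>

definition top_sum :: "nat \<Rightarrow> nat \<Rightarrow> 'r::comm_ring_1 ferm" where
  "top_sum N m E = (if \<exists>k\<in>{m<..N}. E = insert k {1..m} then 1 else 0)"

lemma supported_top_sum: "m < N \<Longrightarrow> supported N (Suc m) (top_sum N m)"
  by (auto simp: supported_def top_sum_def split: if_splits)

lemma T_op_top_sum_above: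
  fixes t :: "'r::idom"
  assumes "m < j" "j < N" "t \<noteq> - 1" "t \<noteq> 0"
  shows "T_op N t j (top_sum N m) = fscale t (top_sum N m)"
proof -
  have swap: "swap_set j (insert j {1..m}) = insert (Suc j) {1..m}"
    using assms(1) unfolding set_eq_iff in_transpose_image_iff by (auto simp: transpose_def)
  have "top_sum N m E = (0 :: 'r)" if "j \<in> E" "Suc j \<in> E" for E
    using that assms(1) by (auto simp: top_sum_def)
  moreover have "top_sum N m (swap_set j E) = (top_sum N m E :: 'r)" if "j \<in> E" "Suc j \<notin> E" for E
  proof -
    have "(\<exists>k\<in>{m<..N}. swap_set j E = insert k {1..m}) \<longleftrightarrow> E = insert j {1..m}"
    proof
      assume "\<exists>k\<in>{m<..N}. swap_set j E = insert k {1..m}"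
      then obtain k where k: "swap_set j E = insert k {1..m}" by blast
      have "Suc j \<in> swap_set j E" using that(1) by (simp add: in_transpose_image_iff)
      then have "k = Suc j" using k assms(1) by auto
      then have "swap_set j E = swap_set j (insert j {1..m})" using k swap by simp
      then show "E = insert j {1..m}" by (simp only: inj_image_eq_iff[OF inj_transpose])
    qed (use swap assms in auto)
    moreover have "(\<exists>k\<in>{m<..N}. E = insert k {1..m}) \<longleftrightarrow> E = insert j {1..m}"
    proof
      assume "\<exists>k\<in>{m<..N}. E = insert k {1..m}"
      then obtain k where k: "E = insert k {1..m}" by blast
      then have "k = j" using that(1) assms(1) by auto
      then show "E = insert j {1..m}" using k by simp
    qed (use assms in auto)
    ultimately show ?thesis unfolding top_sum_def by (simp only:)
  qed
  ultimately show ?thesis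
    using assms by (subst T_op_eq_scale_iff[OF _ _ supported_top_sum]) auto
qed

lemma T_op_top_sum_below:
  assumes "1 \<le> i" "i < m" "m < N"
  shows "T_op N t i (top_sum N m) = - (top_sum N m :: 'r::comm_ring_1 ferm)"
proof
  fix E
  have zero: "top_sum N m G = (0 :: 'r)" if "i \<notin> G \<or> Suc i \<notin> G" for G
    using that assms by (auto simp: top_sum_def)
  have "i \<notin> swap_set i E \<or> Suc i \<notin> swap_set i E" if "i \<notin> E \<or> Suc i \<notin> E"
    using that by (auto simp: in_transpose_image_iff)
  then show "T_op N t i (top_sum N m) E = (- top_sum N m) E"
    using zero[of E] zero[of "swap_set i E"] supportedD[OF supported_top_sum, of m N E] assms
    by (auto simp: T_op_apply)
qed

context
  fixes N m :: nat and t :: "'k::field_char_0"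
  assumes m_less: "m < N" and t: "t \<noteq> 0" and t_pow: "\<And>k. 0 < k \<Longrightarrow> t ^ k \<noteq> 1"
begin

text \<open>A multiple of \<open>\<tau>\<^sub>F\<close>; commutation with \<open>D\<close> transfers the symmetries of \<open>top_sum\<close>.\<close>

definition tau0 :: "'k ferm" where
  "tau0 = D_op N t (top_sum N m)"

lemma t_minus_1: "t \<noteq> - 1"
  using t_pow[of 2] by auto

lemma sum_above_nonzero: "(\<Sum>k\<in>{m<..N}. t ^ (k - 1)) \<noteq> 0"
proof -
  have "{m<..N} = {Suc m..N}" by auto
  then show ?thesis using geometric_sum_nonzero[of "Suc m" N t] m_less t t_pow by auto
qed

lemma tau0_in_Pm0: "tau0 \<in> Pm0 N t m"
  by (simp add: Pm0_iff tau0_def supported_D_op supported_top_sum m_less D_op_D_op)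

lemma sym_above_tau0: "sym_above N m t tau0"
  unfolding sym_above_def tau0_def
  using T_op_top_sum_above[OF _ _ t_minus_1 t] by (auto simp: D_op_T_op[symmetric] D_op_fscale)

lemma T_op_tau0_below:
  assumes "1 \<le> i" "i < m"
  shows "T_op N t i tau0 = - tau0"
proof -
  have "T_op N t i tau0 = D_op N t (- top_sum N m)"
    using assms m_less by (simp add: tau0_def D_op_T_op[symmetric] T_op_top_sum_below)
  also have "\<dots> = - tau0"
    using D_op_diff[of N t 0 "top_sum N m"] by (simp add: tau0_def)
  finally show ?thesis .
qed

lemma tau0_at_first: "tau0 {1..m} \<noteq> 0"
proof -
  have I: "{1..N} - {1..m} = {m<..N}" by auto
  have "D_coeff t {1..m} k * top_sum N m (insert k {1..m}) = t ^ (k - 1) * (- 1) ^ m"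
    if "k \<in> {m<..N}" for k
  proof -
    have "{j \<in> {1..m}. j < k} = {1..m}" using that by auto
    moreover have "top_sum N m (insert k {1..m}) = (1 :: 'k)"
    proof -
      have "\<exists>k'\<in>{m<..N}. insert k {1..m} = insert k' {1..m}" using that by blast
      then show ?thesis by (simp only: top_sum_def if_True)
    qed
    ultimately show ?thesis by (simp add: D_coeff_def)
  qed
  then have "(\<Sum>k\<in>{m<..N}. D_coeff t {1..m} k * top_sum N m (insert k {1..m})) =
      (\<Sum>k\<in>{m<..N}. t ^ (k - 1) * (- 1) ^ m)"
    by (rule sum.cong[OF refl])
  moreover have "{1..m} \<subseteq> {1..N}" using m_less by auto
  ultimately have "tau0 {1..m} = (\<Sum>k\<in>{m<..N}. t ^ (k - 1) * (- 1) ^ m)"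
    unfolding tau0_def D_op_apply I by (simp only: if_True)
  then show ?thesis using sum_above_nonzero by (simp flip: sum_distrib_right)
qed

context
  fixes F :: "nat set"
  assumes F: "F = {1..m} \<union> {N}"
begin

lemma tau0_omega:
  assumes "i \<in> {1..N}"
  shows "omega N t i tau0 = fscale (t powi content N m F i) tau0"
proof (cases "i \<le> m")
  case True
  have border: "omega N t m tau0 = fscale (inverse t) tau0"
    using True assms m_less t t_pow
    by (intro omega_border[OF tau0_in_Pm0 sym_above_tau0]) auto
  show ?thesis
    using True assms omega_antisymmetric[OF t True m_less border] T_op_tau0_below
    by (simp add: content_F[OF m_less F])
next
  case False
  have "omega N t i tau0 = fscale (t ^ (N - i)) tau0"
    using False assms sym_above_tau0 by (intro omega_of_symmetric t) (auto simp: sym_above_def)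
  moreover have "content N m F i = int (N - i)"
    using False assms by (simp add: content_F[OF m_less F] of_nat_diff)
  ultimately show ?thesis
    by (simp only: power_int_of_nat)
qed

text \<open>A multiple of \<open>tau0\<close> satisfies the three defining conditions. Conversely these conditions imply membership in the line of invariants and fix the coefficient at \<open>{1..m}\<close>, so that the definite description denotes this multiple.\<close>

lemma tau_properties:
  shows "supported N m (tau N t m F)" "D_op N t (tau N t m F) = 0" "sym_above N m t (tau N t m F)"
    and "tau N t m F {1..m} \<noteq> 0"
proof -
  let ?v = "(- 1) ^ m * t ^ (N - 1 + invs N F)"
  let ?P = "\<lambda>f. f \<in> Pm0 N t m \<and>
        (\<forall>i\<in>{1..N}. omega N t i f = fscale (t powi content N m F i) f) \<and>
        f - fscale (t ^ invs N F) (psi N t F)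
          \<in> module.span fscale {psi N t G | G. G \<in> Y0 N m \<and> invs N G < invs N F}"
  let ?Q = "\<lambda>f. supported N m f \<and> D_op N t f = 0 \<and> sym_above N m t f \<and> f {1..m} = ?v"
  have PQ: "?Q f" if P: "?P f" for f
  proof -
    have f: "f \<in> Pm0 N t m" using P by blast
    have "omega N t i f = fscale (t ^ (N - i)) f" if i: "m < i" "i \<le> N" for i
    proof -
      have "content N m F i = int (N - i)"
        using i by (simp add: content_F[OF m_less F] of_nat_diff)
      then have "t powi content N m F i = t ^ (N - i)"
        by (simp only: power_int_of_nat)
      then show ?thesis
        using P[THEN conjunct2, THEN conjunct1, THEN bspec, of i] i by simp
    qed
    then have "sym_above N m t f"
      using f by (intro sym_above_of_omega_eigen[OF _ t t_pow]) (auto simp: Pm0_iff)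
    moreover have "f {1..m} = ?v"
      using P triangular_iff[OF m_less F f t] by blast
    ultimately show ?thesis
      using f by (simp add: Pm0_iff)
  qed
  have unique: "f = g" if "?Q f" "?Q g" for f g
  proof -
    have "f - g = 0"
      using that by (intro sym_above_D_kernel_unique[OF supported_diff sym_above_diff t_minus_1 t m_less _ _ sum_above_nonzero])
        (auto simp: D_op_diff)
    then show ?thesis by simp
  qed
  define f where "f = fscale (?v / tau0 {1..m}) tau0"
  have f: "f \<in> Pm0 N t m"
    using tau0_in_Pm0 by (auto simp: f_def Pm0_iff supported_fscale D_op_fscale) (simp add: fscale_def fun_eq_iff)
  have "f {1..m} = ?v"
    using tau0_at_first by (simp add: f_def fscale_def)
  moreover have "omega N t i f = fscale (t powi content N m F i) f" if "i \<in> {1..N}" for i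
    unfolding f_def omega_fscale tau0_omega[OF that] by (simp add: fscale_def mult_ac)
  ultimately have "?P f"
    using triangular_iff[OF m_less F f t] f by blast
  moreover have "h = f" if "?P h" for h
    using unique[OF PQ[OF that] PQ[OF \<open>?P f\<close>]] .
  ultimately have "?P (tau N t m F)"
    unfolding tau_def by (rule theI[of ?P])
  then have "?Q (tau N t m F)" by (rule PQ)
  then show "supported N m (tau N t m F)" "D_op N t (tau N t m F) = 0" "sym_above N m t (tau N t m F)"
    "tau N t m F {1..m} \<noteq> 0"
    using t by auto
qed

end

end

section \<open>Evaluation of symmetric superpolynomials\<close>

text \<open>Algebraic independence is applied to the polynomials \<open>Y\<close> and \<open>Y\<^sup>k - 1\<close> in the variable for \<open>t\<close>, which do not involve \<open>q\<close>.\<close>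

lemma alg_indep2_powers:
  fixes q t :: "'k::field_char_0"
  assumes "alg_indep2 q t"
  shows "t \<noteq> 0" "\<And>k. 0 < k \<Longrightarrow> t ^ k \<noteq> 1"
proof -
  let ?ev = "\<lambda>P :: rat poly poly. poly (map_poly (\<lambda>f. poly (map_poly of_rat f) q) P) t"
  have ind: "P = 0" if "?ev P = 0" for P
    using assms that by (simp add: alg_indep2_def)
  have one: "map_poly of_rat 1 = (1 :: 'k poly)"
    by (simp add: map_poly_1)
  show "t \<noteq> 0"
  proof
    assume "t = 0"
    then have "?ev (monom 1 1) = 0"
      by (simp add: map_poly_monom one poly_monom)
    then show False using ind[of "monom 1 1"] by (simp add: monom_eq_0_iff)
  qed
  fix k :: nat assume k: "0 < k"
  show "t ^ k \<noteq> 1"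
  proof
    assume tk: "t ^ k = 1"
    let ?P = "pCons (- 1) (monom 1 (k - 1)) :: rat poly poly"
    have "map_poly of_rat (- 1) = (- 1 :: 'k poly)"
      by (rule poly_eqI) (simp add: coeff_map_poly coeff_1)
    then have "?ev ?P = - 1 + t * t ^ (k - 1)"
      by (simp add: map_poly_pCons map_poly_monom one poly_monom)
    also have "\<dots> = 0" using tk k by (cases k) auto
    finally show False using ind[of ?P] by simp
  qed
qed

text \<open>The definite description in \<open>div_diff\<close> denotes a genuine quotient: \<open>x\<^sub>i\<close> and \<open>x\<^sub>i\<^sub>+\<^sub>1\<close> are congruent modulo their difference, and a nonzero factor can be cancelled.\<close>

lemma div_diff_mult:
  fixes p :: "'k::idom mpoly"
  shows "div_diff i p * (Var i - Var (Suc i)) = p - swap_vars i p"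
proof -
  have "Var i - Var (Suc i) dvd subst Var p - swap_vars i p"
    unfolding swap_vars_def
  proof (rule subst_dvd_diff)
    fix j
    have "Var (Suc i) - Var i = (Var i - Var (Suc i)) * (- 1 :: 'k mpoly)" by simp
    then show "(Var i - Var (Suc i) :: 'k mpoly) dvd Var j - Var (transpose i (Suc i) j)"
      by (metis cancel_comm_monoid_add_class.diff_cancel dvd_0_right dvd_refl dvd_triv_left transpose_def)
  qed
  then obtain r where r: "r * (Var i - Var (Suc i)) = p - swap_vars i p"
    by (metis dvdE mult.commute subst_Var_id)
  have "prime_elem (Var i - Var (Suc i) :: 'k mpoly)"
    by (rule prime_elem_linear) simp
  then have "Var i - Var (Suc i) \<noteq> (0 :: 'k mpoly)"
    by (simp add: prime_elem_def)
  then have "s = r" if "s * (Var i - Var (Suc i)) = p - swap_vars i p" for s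
    using that r by (metis mult_right_cancel)
  with r show ?thesis
    unfolding div_diff_def by (rule theI2[where P = "\<lambda>s. s * (Var i - Var (Suc i)) = p - swap_vars i p"])
qed

lemma eval_super_T_op:
  assumes "1 \<le> i" "i < N"
  shows "T_op N (Const t) i (eval_super z p) = eval_super z (T_op N (Const t) i p)"
  by (rule ext) (simp add: eval_super_def T_op_apply[OF assms] subst_hom)

lemma subst_D_coeff: "subst z (D_coeff (Const t) G i) = D_coeff (Const t) G i"
  by (simp add: D_coeff_def subst_hom)

lemma eval_super_D_op:
  "D_op N (Const t) (eval_super z p) = eval_super z (D_op N (Const t) p)"
  by (rule ext) (simp add: eval_super_def D_op_apply subst_hom subst_D_coeff)

lemma D_coeff_Const: "D_coeff (Const t) G i = Const (D_coeff t G i)"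
  by (simp add: D_coeff_def Const_mult Const_power Const_minus)

lemma T_op_Const:
  assumes "1 \<le> i" "i < N"
  shows "T_op N (Const t) i (\<lambda>E. Const (f E)) = (\<lambda>E. Const (T_op N t i f E))"
  by (rule ext) (simp add: T_op_apply[OF assms] Const_mult Const_minus Const_add Const_diff)

lemma D_op_Const: "D_op N (Const t) (\<lambda>E. Const (f E)) = (\<lambda>E. Const (D_op N t f E))"
  by (rule ext) (simp add: D_op_apply D_coeff_Const Const_mult Const_sum)

lemma sPm0_supported:
  assumes "p \<in> sPm0 N t m"
  shows "supported N m p"
  unfolding supported_alt
proof (intro allI impI poly_mapping_eqI)
  fix E \<alpha> assume E: "\<not> (E \<subseteq> {1..N} \<and> card E = m)"
  have "supported N m (\<lambda>E. Poly_Mapping.lookup (p E) \<alpha>)"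
    using assms by (simp add: sPm0_def Pm0_iff)
  then show "Poly_Mapping.lookup (p E) \<alpha> = Poly_Mapping.lookup 0 \<alpha>"
    using supportedD[OF _ E] by simp
qed

lemma sPm0_D_op:
  assumes "p \<in> sPm0 N t m"
  shows "D_op N (Const t) p = 0"
proof
  fix G
  show "D_op N (Const t) p G = 0 G"
  proof (rule poly_mapping_eqI)
    fix \<alpha>
    have "D_op N t (\<lambda>E. Poly_Mapping.lookup (p E) \<alpha>) G = 0"
      using assms by (simp add: sPm0_def Pm0_iff)
    moreover have "Poly_Mapping.lookup (D_op N (Const t) p G) \<alpha> = D_op N t (\<lambda>E. Poly_Mapping.lookup (p E) \<alpha>) G"
      by (simp add: D_op_apply D_coeff_Const lookup_sum lookup_Const_mult)
    ultimately show "Poly_Mapping.lookup (D_op N (Const t) p G) \<alpha> = Poly_Mapping.lookup (0 G) \<alpha>"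
      by simp
  qed
qed

text \<open>The symmetry condition, cleared of its denominator and specialized to an arbitrary point.\<close>

lemma symmetric_super_eval:
  fixes t :: "'k::field"
  assumes "symmetric_super N t p" "1 \<le> i" "i < N"
  shows "(z i - z (Suc i)) * T_op N (Const t) i (eval_super (z \<circ> transpose i (Suc i)) p) E =
    (Const t * z i - z (Suc i)) * eval_super z p E
      + Const (1 - t) * z (Suc i) * eval_super (z \<circ> transpose i (Suc i)) p E"
proof -
  let ?sp = "\<lambda>E. swap_vars i (p E)"
  have swap: "eval_super z ?sp = eval_super (z \<circ> transpose i (Suc i)) p"
    by (simp add: eval_super_def swap_vars_def subst_subst comp_def)
  have sym: "Const t * p E = Const (1 - t) * Var (Suc i) * div_diff i (p E) + T_op N (Const t) i ?sp E"
    using assms by (simp add: symmetric_super_def bT_def fun_eq_iff fscale_def)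
  then have "(Var i - Var (Suc i)) * (Const t * p E) = (Var i - Var (Suc i)) * T_op N (Const t) i ?sp E
      + Const (1 - t) * Var (Suc i) * (div_diff i (p E) * (Var i - Var (Suc i)))"
    unfolding sym by (simp add: algebra_simps)
  then have "(Var i - Var (Suc i)) * T_op N (Const t) i ?sp E =
      (Const t * Var i - Var (Suc i)) * p E + Const (1 - t) * Var (Suc i) * ?sp E"
    unfolding div_diff_mult by (simp add: Const_diff algebra_simps)
  then have "subst z ((Var i - Var (Suc i)) * T_op N (Const t) i ?sp E) =
      subst z ((Const t * Var i - Var (Suc i)) * p E + Const (1 - t) * Var (Suc i) * ?sp E)"
    by (rule arg_cong)
  moreover have "subst z (?sp E) = eval_super (z \<circ> transpose i (Suc i)) p E"
    by (simp add: eval_super_def swap_vars_def subst_subst comp_def)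
  moreover have "subst z (T_op N (Const t) i ?sp E) =
      T_op N (Const t) i (eval_super (z \<circ> transpose i (Suc i)) p) E"
    unfolding swap[symmetric] eval_super_T_op[OF assms(2,3)] by (simp add: eval_super_def)
  ultimately show ?thesis
    by (simp add: subst_hom eval_super_def[of z])
qed

text \<open>The previous identity is used at \<open>z s\<^sub>j\<close>, where \<open>z\<close> and \<open>z s\<^sub>j\<close> exchange their roles: the factor \<open>t z\<^sub>j\<^sub>+\<^sub>1 - z\<^sub>j\<close> in front of \<open>p(z s\<^sub>j)\<close> vanishes.\<close>

lemma T_op_eval_geometric:
  fixes t :: "'k::field"
  assumes "symmetric_super N t p" "1 \<le> j" "j < N" "t \<noteq> 1"
    and "z j = Const t * z (Suc j)" "z (Suc j) \<noteq> 0"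
  shows "T_op N (Const t) j (eval_super z p) = fscale (Const t) (eval_super z p)"
proof
  fix E
  let ?T = "T_op N (Const t) j (eval_super z p) E" and ?P = "eval_super z p E"
  have "(z (Suc j) - z j) * ?T = Const (1 - t) * z j * ?P"
    using symmetric_super_eval[OF assms(1-3), of "z \<circ> transpose j (Suc j)" E] assms(5)
    by (simp add: comp_assoc)
  then have "(Const (1 - t) * z (Suc j)) * ?T = (Const (1 - t) * z (Suc j)) * (Const t * ?P)"
    using assms(5) by (simp add: Const_diff algebra_simps)
  moreover have "Const (1 - t) * z (Suc j) \<noteq> 0"
    using assms(4,6) by simp
  ultimately show "?T = fscale (Const t) (eval_super z p) E"
    by (simp add: fscale_def)
qed

theorem proposition4p18:
  fixes q t :: "'k::field_char_0" and N m :: nat and F :: "nat set"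
    and p :: "'k mpoly ferm"
  assumes "alg_indep2 q t"
    and "N \<ge> 2"
    and "m \<le> N - 1"
    and "F = {1..m} \<union> {N}"
    and "p \<in> sPm0 N t m"
    and "symmetric_super N t p"
  shows "\<exists>p0 :: 'k mpoly. sym_poly m p0 \<and>
    eval_super (z_point N t m) p =
      fscale ((\<Prod>(i, j) \<in> {(i, j). 1 \<le> i \<and> i < j \<and> j \<le> m}. Var i - Const t * Var j)
              * (\<Prod>k=1..m. Var k - Const (t ^ (N - m)))
              * p0)
        (\<lambda>E. Const (tau N t m F E))"
proof -
  note t = alg_indep2_powers[OF assms(1)]
  have m_less: "m < N" using assms(2,3) by simp
  have t1: "t \<noteq> 1" and tt: "t * t \<noteq> 1"
    using t(2)[of 1] t(2)[of 2] by (auto simp: power2_eq_square)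
  let ?z = "z_point N t m"
  let ?\<tau> = "tau N t m F"
  note \<tau> = tau_properties[OF m_less t assms(4)]
  have Ct: "Const t \<noteq> - 1" "Const t \<noteq> 0"
    using t_minus_1[OF m_less t] t(1) Const_eq_iff[of t "- 1"] by (simp_all add: Const_minus)
  have sum_Const: "(\<Sum>k\<in>A. Const t ^ (k - 1)) = Const (\<Sum>k\<in>A. t ^ (k - 1))" for A
    by (simp add: Const_sum Const_power)
  have sum1: "(\<Sum>k\<in>{m<..N}. Const t ^ (k - 1)) \<noteq> 0"
    unfolding sum_Const using sum_above_nonzero[OF m_less t] by simp
  have supp: "supported N m (eval_super z p)" for z
    using sPm0_supported[OF assms(5)] by (simp add: supported_alt eval_super_def)
  have kernel: "D_op N (Const t) (eval_super z p) = 0" for z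
    unfolding eval_super_D_op sPm0_D_op[OF assms(5)] by (simp add: eval_super_def fun_eq_iff)
  have z_above: "?z j = Const t * ?z (Suc j)" "?z (Suc j) \<noteq> 0" if "m < j" "j < N" for j
  proof -
    have "N - j = Suc (N - Suc j)" using that by simp
    then show "?z j = Const t * ?z (Suc j)" "?z (Suc j) \<noteq> 0"
      using that t(1) by (simp_all add: z_point_def Const_mult)
  qed
  define P where "P = eval_super ?z p"
  define g where "g = P {1..m}"
  have sym: "sym_above N m (Const t) P"
    unfolding sym_above_def P_def using z_above
    by (intro allI impI T_op_eval_geometric[OF assms(6) _ _ t1]) auto

  \<comment> \<open>Both sides are invariants in the kernel of \<open>D\<close> with the same coefficient at \<open>{1..m}\<close>; dividing by the coefficient of \<open>\<tau>\<^sub>F\<close> is postponed.\<close>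
  have P_tau: "fscale (Const (?\<tau> {1..m})) P = fscale g (\<lambda>E. Const (?\<tau> E))"
  proof -
    let ?C = "\<lambda>E. Const (?\<tau> E)"
    let ?h = "fscale (Const (?\<tau> {1..m})) P - fscale g ?C"
    have "T_op N (Const t) j ?C = fscale (Const t) ?C" if "m < j" "j < N" for j
      using \<tau>(3) that by (simp add: T_op_Const sym_above_def) (simp add: fscale_def Const_mult)
    moreover have "T_op N (Const t) j P = fscale (Const t) P" if "m < j" "j < N" for j
      using sym that by (simp add: sym_above_def)
    ultimately have "sym_above N m (Const t) ?h"
      unfolding sym_above_def T_op_diff T_op_fscale by (auto simp: fscale_def fun_eq_iff algebra_simps)
    moreover have "supported N m ?h"
      using supp[of ?z] \<tau>(1)
      by (intro supported_diff supported_fscale) (auto simp: P_def supported_alt)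
    moreover have "D_op N (Const t) ?h = 0"
      using kernel[of ?z] \<tau>(2) unfolding D_op_diff D_op_fscale D_op_Const P_def
      by (simp add: fscale_def fun_eq_iff)
    moreover have "?h {1..m} = 0"
      by (simp add: g_def fscale_def)
    ultimately have "?h = 0"
      using sym_above_D_kernel_unique[OF _ _ Ct m_less _ _ sum1] by blast
    then show ?thesis by simp
  qed

  have "vars (p {1..m}) \<subseteq> {1..N}"
    using assms(5) by (simp add: sPm0_def)
  then have vars_g: "vars g \<subseteq> {1..m}"
    unfolding g_def P_def eval_super_def
    by (intro vars_subst_subset) (auto simp: z_point_def dest!: subsetD)

  have exchange: "(Const t * Var (Suc i) - Var i) * swap_vars i g = (Const t * Var i - Var (Suc i)) * g"
    if i: "1 \<le> i" "i < m" for i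
  proof -
    \<comment> \<open>At \<open>{1..m}\<close>, which contains \<open>i\<close> and \<open>i + 1\<close>, the operator \<open>T\<^sub>i\<close> is multiplication by \<open>- 1\<close>.\<close>
    let ?P' = "eval_super (?z \<circ> transpose i (Suc i)) p"
    have "swap_vars i (?z j) = ?z (transpose i (Suc i) j)" for j
      using i by (auto simp: z_point_def swap_vars_hom transpose_def)
    then have P': "?P' {1..m} = swap_vars i g"
      by (simp add: g_def P_def eval_super_def swap_vars_def subst_subst comp_def)
    have "T_op N (Const t) i ?P' {1..m} = - swap_vars i g"
      using i m_less by (simp add: T_op_apply P'[symmetric])
    then have "(Var i - Var (Suc i)) * (- swap_vars i g) = (Const t * Var i - Var (Suc i)) * g
        + Const (1 - t) * Var (Suc i) * swap_vars i g"
      using symmetric_super_eval[OF assms(6), of i ?z "{1..m}"] i m_less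
      by (simp only: P') (simp add: z_point_def g_def P_def)
    then show ?thesis
      by (simp add: Const_diff algebra_simps)
  qed

  have vanish: "point_form (t ^ (N - m)) m dvd g" if m: "1 \<le> m"
  proof -
    \<comment> \<open>This substitution prolongs the geometric progression \<open>1, t, t\<^sup>2, \<dots>\<close> to the position \<open>m\<close>.\<close>
    let ?y = "Var(m := Const (t ^ (N - m)))"
    let ?z' = "\<lambda>j. subst ?y (?z j)"
    have z': "?z' j = Const (t ^ (N - j))" if "m \<le> j" for j
      using that by (cases "j = m") (simp_all add: z_point_def)
    have "?z' j = Const t * ?z' (Suc j) \<and> ?z' (Suc j) \<noteq> 0" if "m \<le> j" "j < N" for j
    proof -
      have "N - j = Suc (N - Suc j)" using that by simp
      then show ?thesis using z'[of j] z'[of "Suc j"] that t(1) by (simp add: Const_mult)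
    qed
    then have "sym_above N (m - 1) (Const t) (eval_super ?z' p)"
      unfolding sym_above_def using m
      by (intro allI impI T_op_eval_geometric[OF assms(6) _ _ t1]) auto
    moreover have "(\<Sum>k\<in>{m..N}. Const t ^ (k - 1)) \<noteq> 0"
      unfolding sum_Const using geometric_sum_nonzero[of m N t] m m_less t by simp
    ultimately have "eval_super ?z' p = 0"
      using sym_from_m_D_kernel_zero[OF supp m _ Ct m_less kernel sum1] by blast
    then have "eval_super ?z' p {1..m} = 0" by simp
    then have "subst ?y g = 0"
      by (simp add: g_def P_def eval_super_def subst_subst)
    then show ?thesis
      by (simp add: point_form_def linear_dvd_iff)
  qed

  obtain h where h: "sym_poly m h"
    "g = prod (pair_form t) (increasing_pairs m) * prod (point_form (t ^ (N - m))) {1..m} * h"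
    using exchange_factorization[OF t(1) tt exchange vars_g vanish] by blast
  define p0 where "p0 = Const (inverse (?\<tau> {1..m})) * h"
  have "sym_poly m p0"
    using h(1) by (auto simp: sym_poly_def p0_def subst_hom dest!: subsetD[OF vars_mult])
  moreover have "P = fscale (prod (pair_form t) (increasing_pairs m)
      * prod (point_form (t ^ (N - m))) {1..m} * p0) (\<lambda>E. Const (?\<tau> E))"
  proof -
    let ?a = "?\<tau> {1..m}"
    have inv: "Const (inverse ?a) * Const ?a = 1"
      using \<tau>(4) by (simp flip: Const_mult)
    have "P = fscale (Const (inverse ?a)) (fscale (Const ?a) P)"
      using inv by (simp add: fscale_def fun_eq_iff flip: mult.assoc)
    also have "\<dots> = fscale (Const (inverse ?a) * g) (\<lambda>E. Const (?\<tau> E))"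
      unfolding P_tau by (simp add: fscale_def mult.assoc)
    finally show ?thesis
      by (simp only: h(2) p0_def mult_ac)
  qed
  ultimately show ?thesis
    unfolding P_def pair_form_def point_form_def by blast
qed

end
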